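(* Let $m,d_1,\ldots,d_m\in\mathbb N$, $N,B>0$ and $C\ge0$. Put $$\kappa_1:=2\mathcal D\gamma_1,\qquad\kappa_2:=2\mathcal D\big(N+2^{2(1+2\gamma_0)}\big).$$ Then for any function $f:\mathbb Z^m\to\mathbb C$ satisfying $$|f(\mathbf n)|\le B\prod_{\substack{1\le j\le m\\ n_j\neq0}}\tau(|n_j|)^C\quad\text{for all }\mathbf n\in\mathbb Z^m,$$ any $a:\mathbb Z^2\to\{z\in\mathbb C:|z|\le1\}$, all $H\ge3$ and all $x$ in the range $(\log H)^{\kappa_1+\kappa_2}\le x\le H$, we have $$\frac1{\#\mathcal F_{\mathbb Z}(H)}\sum_{\mathbf F\in\mathcal F_{\mathbb Z}(H)}\Bigg|\frac1{x^2}\sum_{\mathbf n\in\mathbb Z^2\cap[-x,x]^2}a(\mathbf n)f(F_1(\mathbf n),\ldots,F_m(\mathbf n))\Bigg|^2$$ $$\ll\frac1{(\log x)^N}+(\log H)^{2m\kappa_1}(\log x)^{2m\kappa_2+m}x^{4d}\left(\max_{\substack{\mathbf q\in(\mathbb Z\setminus\{0\})^m\\|q_j|\le2x^{2d_j}\ \forall j}}\frac{\mathcal E_f\big(((1+d_j)x^{d_j}H)_{j=1}^m;\mathbf q\big)}{H^m}\right)^2,$$ where the implied constant depends only on $m,d_1,\ldots,d_m,B,C$ and $N$.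
   Context: $\mathbb N=\{1,2,\dots\}$; $\tau$ is the divisor function; empty products are $1$; $A\ll B$ means $|A|\le cB$ for a constant $c$. Here $d=d_1+\cdots+d_m$, $\mathcal D=\max\{d_1,\ldots,d_m\}$, $$\gamma_0=\sum_{j=1}^md_j\big(1+C(d_j+2)\big),\qquad\gamma_1=\sum_{j=1}^m2^{2C(d_j+2)+1}.$$ $\mathcal F_{\mathbb Z}(H)$ is the set of vectors $\mathbf F=(F_1,\ldots,F_m)$ of binary forms $F_i\in\mathbb Z[t_1,t_2]$, $F_i$ homogeneous of degree $d_i$ (the zero form is allowed), with all coefficients in $[-H,H]$. For $\mathbf q\in(\mathbb Z\setminus\{0\})^m$ and $\mathbf x\in[1,\infty)^m$, $$\mathcal E_f(\mathbf x;\mathbf q)=\max_{\mathbf r\in\prod_{j=1}^m(\mathbb Z/q_j\mathbb Z)}\ \sup_{\substack{\mathbf v\in\mathbb R^m\\|v_k|\le x_k\ \forall k}}\Bigg|\sum_{\substack{\mathbf t\in\mathbb Z^m,\ -x_k\le t_k\le v_k\ \forall k\\ t_k\equiv r_k\ (\mathrm{mod}\ q_k)\ \forall k}}f(\mathbf t)\Bigg|.$$ *)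

theory Defs
  imports Complex_Main
    "HOL-Computational_Algebra.Polynomial"
    "HOL-Number_Theory.Cong"
    "HOL-Library.Cardinality"
begin

text \<open>Vectors indexed by \<open>1, \<dots>, m\<close> are functions on a finite type \<open>'m\<close>, so that
  \<open>m = CARD('m)\<close>; in particular \<open>\<int>\<^sup>m\<close> is the type \<open>'m \<Rightarrow> int\<close>.\<close>

definition divisor_tau :: "nat \<Rightarrow> nat" where
  "divisor_tau n = card {k. k dvd n}"


text \<open>The ring \<open>\<int>[t\<^sub>1, t\<^sub>2]\<close> is \<open>int poly poly\<close>, read as \<open>\<int>[t\<^sub>1][t\<^sub>2]\<close>: the coefficient of
  the monomial with exponent \<open>i\<close> of \<open>t\<^sub>1\<close> and \<open>k\<close> of \<open>t\<^sub>2\<close> is \<open>coeff (coeff F k) i\<close>.\<close>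

definition bicoeff :: "int poly poly \<Rightarrow> nat \<Rightarrow> nat \<Rightarrow> int" where
  "bicoeff F i k = coeff (coeff F k) i"

definition bieval :: "int poly poly \<Rightarrow> int \<times> int \<Rightarrow> int" where
  "bieval F n = poly (poly F [:snd n:]) (fst n)"

text \<open>The zero polynomial is a binary form of every degree.\<close>

definition binary_form :: "nat \<Rightarrow> int poly poly \<Rightarrow> bool" where
  "binary_form d F \<longleftrightarrow> (\<forall>i k. bicoeff F i k \<noteq> 0 \<longrightarrow> i + k = d)"

definition forms_Z :: "('m::finite \<Rightarrow> nat) \<Rightarrow> real \<Rightarrow> ('m \<Rightarrow> int poly poly) set" where
  "forms_Z d H = {F. \<forall>j. binary_form (d j) (F j) \<and>
                         (\<forall>i k. real_of_int \<bar>bicoeff (F j) i k\<bar> \<le> H)}"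


text \<open>Residue classes modulo \<open>q j\<close> are given by their representatives in \<open>{0..<\<bar>q j\<bar>}\<close>.
  The maximum is over a finite nonempty set if all \<open>q j\<close> are nonzero. The supremum is that of a
  bounded nonempty set if all \<open>x j \<ge> 0\<close>, because only finitely many different sums occur.\<close>

definition equidist_error ::
    "(('m::finite \<Rightarrow> int) \<Rightarrow> complex) \<Rightarrow> ('m \<Rightarrow> real) \<Rightarrow> ('m \<Rightarrow> int) \<Rightarrow> real" where
  "equidist_error f x q =
     (MAX r\<in>{r. \<forall>j. r j \<in> {0..<\<bar>q j\<bar>}}.
        SUP v\<in>{v :: 'm \<Rightarrow> real. \<forall>k. \<bar>v k\<bar> \<le> x k}.
          cmod (\<Sum>t\<in>{t. \<forall>k. - x k \<le> real_of_int (t k) \<and> real_of_int (t k) \<le> v k \<and>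
                              [t k = r k] (mod q k)}. f t))"


definition gamma0 :: "real \<Rightarrow> ('m::finite \<Rightarrow> nat) \<Rightarrow> real" where
  "gamma0 C d = (\<Sum>j\<in>UNIV. real (d j) * (1 + C * (real (d j) + 2)))"

definition gamma1 :: "real \<Rightarrow> ('m::finite \<Rightarrow> nat) \<Rightarrow> real" where
  "gamma1 C d = (\<Sum>j\<in>UNIV. 2 powr (2 * C * (real (d j) + 2) + 1))"

definition max_degree :: "('m::finite \<Rightarrow> nat) \<Rightarrow> nat" where
  "max_degree d = Max (range d)"

definition kappa1 :: "real \<Rightarrow> ('m::finite \<Rightarrow> nat) \<Rightarrow> real" where
  "kappa1 C d = 2 * real (max_degree d) * gamma1 C d"

definition kappa2 :: "real \<Rightarrow> real \<Rightarrow> ('m::finite \<Rightarrow> nat) \<Rightarrow> real" where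
  "kappa2 N C d = 2 * real (max_degree d) * (N + 2 powr (2 * (1 + 2 * gamma0 C d)))"

end

theory Submission
  imports Defs "HOL-Analysis.Harmonic_Numbers"
begin

text \<open>
  Expanding the square, the mean over \<open>F\<close> becomes \<open>x\<^sup>-\<^sup>4\<close> times a sum, over pairs of points
  \<open>n\<^sub>1, n\<^sub>2\<close>, of correlations: the mean over \<open>F\<close> of \<open>f(F(n\<^sub>1))\<close> times the conjugate of
  \<open>f(F(n\<^sub>2))\<close>. Pairs are treated according to whether \<open>n\<^sub>1\<close> and \<open>n\<^sub>2\<close> are linearly dependent.

  If they are independent, each coordinate has a binary form \<open>P\<^sub>j\<close> of degree \<open>d\<^sub>j\<close> with coefficients
  at most \<open>x\<close> that vanishes at \<open>n\<^sub>2\<close> but takes a value \<open>q\<^sub>j \<noteq> 0\<close> at \<open>n\<^sub>1\<close>, where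
  \<open>|q\<^sub>j| \<le> 2 x\<^bsup>d\<^sub>j + 1\<^esup> \<le> 2 x\<^bsup>2 d\<^sub>j\<^esup>\<close>. The box of coefficient vectors is cut into lines in the directions
  \<open>P\<^sub>j\<close>. Along them \<open>F(n\<^sub>2)\<close> is constant, while each \<open>F\<^sub>j(n\<^sub>1)\<close> runs through all members of a residue
  class modulo \<open>q\<^sub>j\<close> in some interval, so that the sum of \<open>f(F(n\<^sub>1))\<close> is at most \<open>2\<^sup>m\<close> times the
  equidistribution error (lemma \<open>line_bundle_sum_le\<close>). The remaining sum of
  \<open>|f(F(n\<^sub>2))|\<close> over the lines is compared with a sum over a box of twice the size: prolonged into
  the larger box, every line has at least \<open>H / x\<close> points, up to a constant factor
  (lemma \<open>sum_over_line_roots_le\<close>).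

  There are only \<open>O(x\<^sup>3)\<close> dependent pairs, and for these it is enough to bound the second moment of
  \<open>f(F(n))\<close> for one point \<open>n\<close>; the sum over the larger box above is bounded by the same moment. Here
  the divisor bound on \<open>f\<close> enters. A number below
  \<open>Y\<^sup>K\<close> has a divisor \<open>e \<le> Y\<close> whose number of divisors controls its own up to a bounded power
  (lemma \<open>divisor_tau_le_small_divisor\<close>), so the values \<open>F\<^sub>j(n)\<close>, which are at most a power of
  \<open>H\<close>, need only be counted in multiples of \<open>e \<ll> H\<close>. At a primitive point a proportion \<open>O(1/e)\<close>
  of all forms has a value divisible by \<open>e\<close> (lemma \<open>card_form_value_dvd_le\<close>). A non-primitive
  point costs a power of \<open>\<tau>(gcd(n))\<close>, which the bound \<open>\<tau>(g)\<^sup>A \<ll> g\<^sup>\<epsilon>\<close> absorbs. Hence the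
  second moment is at most a small power of \<open>x\<close> times a power of \<open>log H\<close>; the exponent of the
  latter is at most a quarter of \<open>\<kappa>\<^sub>1 + \<kappa>\<^sub>2\<close> (lemma \<open>moment_exponents_le_kappa\<close>), so the range of
  \<open>x\<close> makes it a small power of \<open>x\<close> as well.

  Altogether the mean square is \<open>O(x\<^bsup>-1/2\<^esup> + x\<^bsup>m + 1/2\<^esup> E)\<close>, where \<open>E\<close> is the normalised maximal
  equidistribution error. The first term is at most a constant times \<open>(log x)\<^bsup>-N\<^esup>\<close>. The second is at most
  \<open>(log x)\<^bsup>-N\<^esup> + (log x)\<^sup>N x\<^bsup>2m + 1\<^esup> E\<^sup>2\<close> by the inequality of arithmetic and geometric means,
  and \<open>2m + 1 \<le> 4d\<close>.
\<close>

section \<open>Moments of the divisor function\<close>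

lemma divisor_tau_ge_1: "n > 0 \<Longrightarrow> divisor_tau n \<ge> 1"
proof -
  assume "n > 0"
  then have "finite {k. k dvd n}" "1 \<in> {k. k dvd n}"
    by (auto simp: finite_divisors_nat)
  then show ?thesis
    unfolding divisor_tau_def by (metis One_nat_def Suc_leI card_gt_0_iff empty_iff)
qed

text \<open>Every divisor of a product is a product of divisors of the factors.\<close>

lemma divisor_tau_mult_le:
  assumes "m > 0" "n > 0"
  shows "divisor_tau (m * n) \<le> divisor_tau m * divisor_tau n"
proof -
  have "{k. k dvd m * n} \<subseteq> (\<lambda>(a, b). a * b) ` ({k. k dvd m} \<times> {k. k dvd n})"
  proof
    fix k assume "k \<in> {k. k dvd m * n}"
    then obtain a b where "k = a * b" "a dvd m" "b dvd n"
      using division_decomp[of k m n] by blast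
    then show "k \<in> (\<lambda>(a, b). a * b) ` ({k. k dvd m} \<times> {k. k dvd n})"
      by (intro image_eqI[of _ _ "(a, b)"]) auto
  qed
  then have "card {k. k dvd m * n} \<le> card ({k. k dvd m} \<times> {k. k dvd n})"
    using assms by (intro surj_card_le) (auto simp: finite_divisors_nat)
  then show ?thesis
    by (simp add: divisor_tau_def card_cartesian_product)
qed

lemma divisor_tau_power_le:
  assumes "n > 0"
  shows "divisor_tau (n ^ k) \<le> divisor_tau n ^ k"
proof (induction k)
  case 0
  then show ?case by (simp add: divisor_tau_def)
next
  case (Suc k)
  have "divisor_tau (n ^ Suc k) \<le> divisor_tau n * divisor_tau (n ^ k)"
    using divisor_tau_mult_le[of n "n ^ k"] assms by simp
  also have "\<dots> \<le> divisor_tau n * divisor_tau n ^ k"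
    using Suc by simp
  finally show ?case by simp
qed

lemma divisor_tau_prime: "prime p \<Longrightarrow> divisor_tau p = 2"
proof -
  assume p: "prime p"
  then have "k dvd p \<longleftrightarrow> k = 1 \<or> k = p" for k
    by (metis dvd_refl one_dvd prime_nat_iff)
  then have "{k. k dvd p} = {1, p}" by blast
  moreover have "p \<noteq> 1" using p by auto
  ultimately show ?thesis by (simp add: divisor_tau_def)
qed

text \<open>The least divisor that is at least \<open>w\<close> works: if it factors non-trivially, then both
  factors are smaller divisors, hence below \<open>w\<close>.\<close>

lemma divisor_prime_or_between:
  fixes w :: real
  assumes "n > 0" "1 \<le> w" "w \<le> real n"
  shows "\<exists>g. g dvd n \<and> w \<le> real g \<and> (prime g \<or> real g \<le> w\<^sup>2)"
proof -
  define g where "g = (LEAST g. g dvd n \<and> w \<le> real g)"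
  have g: "g dvd n \<and> w \<le> real g"
    unfolding g_def by (rule LeastI[of _ n]) (use assms in auto)
  have least: "g \<le> a" if "a dvd n" "w \<le> real a" for a
    unfolding g_def by (rule Least_le) (use that in auto)
  have "real g \<le> w\<^sup>2" if np: "\<not> prime g"
  proof (cases "g = 1")
    case True
    then show ?thesis using assms by (simp add: power2_eq_square mult_ge1_I)
  next
    case False
    moreover have "g > 0" using g assms by (auto intro: Nat.gr0I)
    ultimately have "\<exists>a. a dvd g \<and> a \<noteq> 1 \<and> a \<noteq> g"
      using np by (auto simp: prime_nat_iff)
    then obtain a b where ab: "g = a * b" "a \<noteq> 1" "a \<noteq> g" by (auto elim: dvdE)
    have "a dvd n" "b dvd n"
      using g ab by (auto intro: dvd_trans dvd_mult_left dvd_mult_right)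
    moreover have "a < g" "b < g"
      using ab \<open>g > 0\<close> by (auto simp: nat_neq_iff)
    ultimately have "real a \<le> w" "real b \<le> w" using least by fastforce+
    then show ?thesis using ab assms by (simp add: power2_eq_square mult_mono)
  qed
  then show ?thesis using g by blast
qed

text \<open>A form of Landreau's inequality. Divisors \<open>g \<ge> w\<close> of \<open>n\<close> are split off one at a time, which is
  possible fewer than \<open>L\<close> times. Each \<open>g\<close> is either at most \<open>w\<^sup>2\<close>, and then competes for the role of
  \<open>e\<close>, or is prime, and then costs only a factor \<open>2\<close>. Among the pieces that are at most \<open>w\<^sup>2\<close>,
  which include the last cofactor, \<open>e\<close> is one with the most divisors.\<close>

lemma divisor_tau_le_small_divisor:
  fixes w :: real
  assumes "n > 0" "1 \<le> w" "real n < w ^ L"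
  shows "\<exists>e. e dvd n \<and> real e \<le> w\<^sup>2 \<and> divisor_tau n \<le> (2 * divisor_tau e) ^ L"
  using assms
proof (induction L arbitrary: n)
  case 0
  then show ?case by simp
next
  case (Suc L)
  have tau_n: "divisor_tau n \<ge> 1" using Suc.prems by (intro divisor_tau_ge_1)
  show ?case
  proof (cases "w \<le> real n")
    case False
    have "divisor_tau n \<le> (2 * divisor_tau n) ^ Suc L"
      using self_le_power[of "2 * divisor_tau n" "Suc L"] tau_n by linarith
    moreover have "w \<le> w\<^sup>2" using Suc.prems by (simp add: power2_eq_square)
    ultimately show ?thesis using False by (intro exI[of _ n]) auto
  next
    case True
    then obtain g where g: "g dvd n" "w \<le> real g" "prime g \<or> real g \<le> w\<^sup>2"
      using divisor_prime_or_between Suc.prems by blast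
    then obtain k where k: "n = g * k" by (auto elim: dvdE)
    have pos: "g > 0" "k > 0" using k Suc.prems by (auto intro: Nat.gr0I)
    have "w * real k \<le> real g * real k" using g by (intro mult_right_mono) auto
    also have "\<dots> < w * w ^ L" using k Suc.prems by simp
    finally have "real k < w ^ L"
      using Suc.prems(2) by (metis mult_less_cancel_left_pos zero_less_one order_less_le_trans)
    then obtain e where e: "e dvd k" "real e \<le> w\<^sup>2" "divisor_tau k \<le> (2 * divisor_tau e) ^ L"
      using Suc.IH[OF pos(2) Suc.prems(2)] by blast
    have "e > 0" using e pos by (auto intro: Nat.gr0I)
    then have tau_e: "divisor_tau e \<ge> 1" by (rule divisor_tau_ge_1)
    have split: "divisor_tau n \<le> divisor_tau g * divisor_tau k"
      using k pos divisor_tau_mult_le by simp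
    show ?thesis
    proof (cases "divisor_tau g \<le> 2 * divisor_tau e")
      case True
      note split
      also have "divisor_tau g * divisor_tau k \<le> (2 * divisor_tau e) * (2 * divisor_tau e) ^ L"
        using True e(3) by (intro mult_le_mono)
      finally have "divisor_tau n \<le> (2 * divisor_tau e) ^ Suc L" by simp
      moreover have "e dvd n" using e(1) k by simp
      ultimately show ?thesis using e(2) by blast
    next
      case False
      have "\<not> prime g" using False tau_e divisor_tau_prime[of g] by linarith
      then have "real g \<le> w\<^sup>2" using g(3) by blast
      have "2 * divisor_tau e \<le> 2 * divisor_tau g" using False tau_e by linarith
      then have "(2 * divisor_tau e) ^ L \<le> (2 * divisor_tau g) ^ L"
        by (rule power_mono) simp
      then have "divisor_tau k \<le> (2 * divisor_tau g) ^ L" using e(3) by (rule order_trans[rotated])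
      note split
      also have "divisor_tau g * divisor_tau k \<le> (2 * divisor_tau g) * (2 * divisor_tau g) ^ L"
        using \<open>divisor_tau k \<le> (2 * divisor_tau g) ^ L\<close> by (intro mult_le_mono) simp
      finally have "divisor_tau n \<le> (2 * divisor_tau g) ^ Suc L" by simp
      then show ?thesis using g(1) \<open>real g \<le> w\<^sup>2\<close> by blast
    qed
  qed
qed

text \<open>The value at \<open>0\<close> is \<open>1\<close> because the pointwise bound on \<open>f\<close> omits the vanishing coordinates.\<close>

definition tau_weight :: "real \<Rightarrow> int \<Rightarrow> real" where
  "tau_weight A k = (if k = 0 then 1 else real (divisor_tau (nat \<bar>k\<bar>)) powr A)"

lemma tau_weight_ge_0: "tau_weight A k \<ge> 0"
  by (simp add: tau_weight_def)

lemma tau_weight_square: "(tau_weight A k)\<^sup>2 = tau_weight (2 * A) k"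
  by (simp add: tau_weight_def power2_eq_square flip: powr_add)

lemma tau_weight_mult_le:
  assumes "A \<ge> 0" "k > 0"
  shows "tau_weight A (int k * l) \<le> real (divisor_tau k) powr A * tau_weight A l"
proof (cases "l = 0")
  case True
  then show ?thesis
    using assms divisor_tau_ge_1[of k] by (simp add: tau_weight_def ge_one_powr_ge_zero)
next
  case False
  have "real (divisor_tau (k * nat \<bar>l\<bar>)) powr A
      \<le> (real (divisor_tau k) * real (divisor_tau (nat \<bar>l\<bar>))) powr A"
    unfolding of_nat_mult[symmetric] using divisor_tau_mult_le[of k "nat \<bar>l\<bar>"] assms False
    by (intro powr_mono2 of_nat_mono) auto
  then show ?thesis
    using assms False by (simp add: tau_weight_def powr_mult abs_mult nat_mult_distrib)
qed

text \<open>This turns the weight of a large value into a count of small divisors, so that the sum over the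
  forms can be exchanged with a sum over \<open>e \<le> Y\<close>. The small divisor lemma is applied with
  \<open>w = sqrt Y\<close> and \<open>L = 2 K\<close>.\<close>

lemma tau_weight_le_sum_divisors:
  assumes "A \<ge> 0" "Y \<ge> 1" "\<bar>k\<bar> < int (Y ^ K)" "2 * real K * A \<le> real b"
  shows "tau_weight A k \<le> 2 ^ b * (\<Sum>e | e \<in> {1..Y} \<and> int e dvd k. real (divisor_tau e) ^ b)"
    (is "_ \<le> _ * sum ?g ?D")
proof -
  have ge: "?g e \<le> sum ?g ?D" if "e \<in> ?D" for e
    by (rule member_le_sum) (use that in auto)
  show ?thesis
  proof (cases "k = 0")
    case True
    have "1 \<le> sum ?g ?D"
      using ge[of 1] True assms by (simp add: divisor_tau_def)
    then have "1 * 1 \<le> 2 ^ b * sum ?g ?D" by (intro mult_mono) auto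
    then show ?thesis using True by (simp add: tau_weight_def)
  next
    case False
    have "\<bar>real_of_int k\<bar> < real Y ^ K"
      using assms(3) by (metis of_int_abs of_int_less_iff of_int_of_nat_eq of_nat_power)
    then have "real (nat \<bar>k\<bar>) < sqrt (real Y) ^ (2 * K)"
      by (simp add: power_mult)
    then obtain e where e: "e dvd nat \<bar>k\<bar>" "real e \<le> (sqrt (real Y))\<^sup>2"
        and tau: "divisor_tau (nat \<bar>k\<bar>) \<le> (2 * divisor_tau e) ^ (2 * K)"
      using divisor_tau_le_small_divisor[of "nat \<bar>k\<bar>" "sqrt (real Y)" "2 * K"] assms False
      by (auto simp: real_sqrt_ge_one)
    have "e > 0" using e False by (auto intro: Nat.gr0I)
    then have tau_e: "divisor_tau e \<ge> 1" by (rule divisor_tau_ge_1)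
    have "tau_weight A k \<le> real ((2 * divisor_tau e) ^ (2 * K)) powr A"
      unfolding tau_weight_def using False assms(1) of_nat_mono[OF tau, where 'a = real]
      by (simp add: powr_mono2 del: of_nat_power)
    also have "\<dots> = real (2 * divisor_tau e) powr (2 * real K * A)"
    proof -
      have "real (2 * divisor_tau e) > 0" using tau_e by simp
      then have "real (2 * divisor_tau e) ^ (2 * K) = real (2 * divisor_tau e) powr real (2 * K)"
        by (simp only: powr_realpow)
      then show ?thesis by (simp only: of_nat_power powr_powr of_nat_mult of_nat_numeral)
    qed
    also have "\<dots> \<le> real (2 * divisor_tau e) powr real b"
      using assms tau_e by (intro powr_mono) auto
    also have "\<dots> = 2 ^ b * ?g e"
      using tau_e by (simp add: powr_realpow power_mult_distrib)
    also have "\<dots> \<le> 2 ^ b * sum ?g ?D"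
      using ge[of e] e \<open>e > 0\<close> by (intro mult_left_mono) auto
    finally show ?thesis .
  qed
qed

lemma sum_over_divisors_le:
  fixes g :: "nat \<Rightarrow> real"
  assumes "\<And>n. g n \<ge> 0"
  shows "(\<Sum>e=1..Y. real (divisor_tau e) * g e) \<le> (\<Sum>a=1..Y. \<Sum>b=1..Y. g (a * b))"
proof -
  have "(\<Sum>e=1..Y. real (divisor_tau e) * g e) = (\<Sum>e=1..Y. \<Sum>a | a dvd e. g e)"
    by (simp add: divisor_tau_def)
  also have "\<dots> = (\<Sum>(e, a)\<in>(SIGMA e:{1..Y}. {a. a dvd e}). g e)"
    by (rule sum.Sigma) (auto simp: finite_divisors_nat)
  also have "\<dots> = (\<Sum>(a, b)\<in>(\<lambda>(e, a). (a, e div a)) ` (SIGMA e:{1..Y}. {a. a dvd e}). g (a * b))"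
    by (subst sum.reindex) (auto simp: inj_on_def intro!: sum.cong elim!: dvdE)
  also have "\<dots> \<le> (\<Sum>(a, b)\<in>{1..Y} \<times> {1..Y}. g (a * b))"
  proof (rule sum_mono2)
    show "(\<lambda>(e, a). (a, e div a)) ` (SIGMA e:{1..Y}. {a. a dvd e}) \<subseteq> {1..Y} \<times> {1..Y}"
    proof safe
      fix e a :: nat
      assume e: "e \<in> {1..Y}" "a dvd e"
      then have "a > 0" "e div a > 0" by (auto elim!: dvdE)
      moreover have "a \<le> e" "e div a \<le> e" using e by (auto dest: dvd_imp_le)
      moreover have "e \<le> Y" using e by simp
      ultimately have "1 \<le> a \<and> a \<le> Y" "1 \<le> e div a \<and> e div a \<le> Y" by linarith+
      then show "a \<in> {1..Y}" "e div a \<in> {1..Y}" by simp_all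
    qed
  qed (use assms in auto)
  finally show ?thesis by (simp add: sum.cartesian_product)
qed

text \<open>One factor \<open>\<tau>(e)\<close> counts the factorisations \<open>e = k l\<close>, so by submultiplicativity raising the
  exponent by one at most squares the sum.\<close>

lemma divisor_tau_moment_le:
  "(\<Sum>e=1..Y. real (divisor_tau e) ^ a / real e) \<le> (harm Y) ^ (2 ^ a)"
proof (induction a)
  case 0
  then show ?case by (simp add: harm_def inverse_eq_divide)
next
  case (Suc a)
  let ?g = "\<lambda>e. real (divisor_tau e) ^ a / real e"
  have "(\<Sum>e=1..Y. real (divisor_tau e) ^ Suc a / real e) \<le> (\<Sum>k=1..Y. \<Sum>l=1..Y. ?g (k * l))"
    using sum_over_divisors_le[of ?g Y] by simp
  also have "\<dots> \<le> (\<Sum>k=1..Y. \<Sum>l=1..Y. ?g k * ?g l)"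
  proof (intro sum_mono)
    fix k l assume "k \<in> {1..Y}" "l \<in> {1..Y}"
    then have "divisor_tau (k * l) \<le> divisor_tau k * divisor_tau l"
      by (intro divisor_tau_mult_le) auto
    then have "real (divisor_tau (k * l)) ^ a \<le> (real (divisor_tau k) * real (divisor_tau l)) ^ a"
      unfolding of_nat_mult[symmetric] by (intro power_mono of_nat_mono) auto
    then show "?g (k * l) \<le> ?g k * ?g l"
      by (simp add: power_mult_distrib divide_right_mono)
  qed
  also have "\<dots> = (\<Sum>k=1..Y. ?g k)\<^sup>2"
    by (simp add: power2_eq_square sum_product)
  also have "\<dots> \<le> (harm Y ^ (2 ^ a))\<^sup>2"
    using Suc by (intro power_mono sum_nonneg) auto
  also have "\<dots> = harm Y ^ (2 ^ Suc a)"
    by (simp add: mult.commute flip: power_mult)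
  finally show ?case .
qed

lemma harm_le_one_plus_ln: "Y \<ge> 1 \<Longrightarrow> harm Y \<le> 1 + ln (real Y)"
proof (induction Y rule: nat_induct_at_least)
  case base
  then show ?case by (simp add: harm_def)
next
  case (Suc Y)
  have "ln (real Y / real (Suc Y)) \<le> real Y / real (Suc Y) - 1"
    using Suc by (intro ln_le_minus_one) auto
  then have "1 / real (Suc Y) \<le> ln (real (Suc Y)) - ln (real Y)"
    using Suc by (simp add: ln_div field_simps)
  then show ?case using Suc by (simp add: harm_Suc inverse_eq_divide)
qed

lemma one_plus_ln_powr_le:
  assumes "\<epsilon> > 0" "K \<ge> 0"
  shows "\<exists>c>0. \<forall>x\<ge>1. (1 + ln x) powr K \<le> c * x powr (\<epsilon>::real)"
proof -
  define \<delta> where "\<delta> = \<epsilon> / (K + 1)"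
  have \<delta>: "\<delta> > 0" "\<delta> * K \<le> \<epsilon>" using assms by (auto simp: \<delta>_def field_simps)
  have "(1 + ln x) powr K \<le> (1 + 1 / \<delta>) powr K * x powr \<epsilon>" if "x \<ge> 1" for x
  proof -
    have "1 + ln x \<le> x powr \<delta> + x powr \<delta> / \<delta>"
      using that \<delta> by (intro add_mono ln_powr_bound ge_one_powr_ge_zero) auto
    also have "\<dots> = (1 + 1 / \<delta>) * x powr \<delta>" by (simp add: algebra_simps)
    finally have "(1 + ln x) powr K \<le> ((1 + 1 / \<delta>) * x powr \<delta>) powr K"
      using assms that by (intro powr_mono2) auto
    also have "\<dots> = (1 + 1 / \<delta>) powr K * x powr (\<delta> * K)"
      using \<delta> by (simp add: powr_mult powr_powr)
    also have "\<dots> \<le> (1 + 1 / \<delta>) powr K * x powr \<epsilon>"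
      using \<delta> that by (intro mult_left_mono powr_mono) auto
    finally show ?thesis .
  qed
  moreover have "(1 + 1 / \<delta>) powr K > 0"
    using \<delta> by (simp add: add_pos_pos less_imp_neq[symmetric])
  ultimately show ?thesis by blast
qed

text \<open>A single term of the moment sum is at most the whole sum. This gives
  \<open>\<tau>(n)\<^sup>a \<le> n (1 + log n)\<^bsup>2^a\<^esup> \<ll> n\<^sup>2\<close> for every \<open>a\<close>, and a root of large order makes the exponent
  of \<open>n\<close> as small as desired.\<close>

lemma divisor_tau_powr_le:
  assumes "\<epsilon> > 0" "A \<ge> 0"
  shows "\<exists>c>0. \<forall>n>0. real (divisor_tau n) powr A \<le> c * real n powr \<epsilon>"
proof -
  define a where "a = nat \<lceil>2 * A / \<epsilon>\<rceil> + 1"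
  have a: "real a > 0" "2 * A / real a \<le> \<epsilon>"
  proof -
    have "2 * A / \<epsilon> \<le> real a" "real a > 0" unfolding a_def by linarith+
    then show "2 * A / real a \<le> \<epsilon>" using assms by (simp add: field_simps)
  qed (simp add: a_def)
  obtain c :: real where c: "c > 0" "\<And>x. x \<ge> 1 \<Longrightarrow> (1 + ln x) powr (2 ^ a) \<le> c * x powr 1"
    using one_plus_ln_powr_le[of 1 "2 ^ a"] by fastforce
  have "real (divisor_tau n) powr A \<le> c powr (A / real a) * real n powr \<epsilon>" if n: "n > 0" for n
  proof -
    let ?t = "real (divisor_tau n)"
    have t: "?t \<ge> 1" using n divisor_tau_ge_1[of n] by linarith
    have "?t ^ a / real n \<le> (\<Sum>e=1..n. real (divisor_tau e) ^ a / real e)"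
      by (rule member_le_sum[of n]) (use n in auto)
    also have "\<dots> \<le> (harm n) ^ (2 ^ a)" by (rule divisor_tau_moment_le)
    also have "\<dots> \<le> (1 + ln (real n)) ^ (2 ^ a)"
      using n by (intro power_mono harm_le_one_plus_ln harm_nonneg) auto
    also have "\<dots> = (1 + ln (real n)) powr (2 ^ a)"
      using n by (subst powr_realpow[symmetric]) (auto simp: add_pos_nonneg)
    also have "\<dots> \<le> c * real n" using c(2)[of "real n"] n by simp
    finally have "?t ^ a \<le> c * real n powr 2"
      using n by (simp add: field_simps power2_eq_square)
    then have "(?t ^ a) powr (A / real a) \<le> (c * real n powr 2) powr (A / real a)"
      using assms by (intro powr_mono2) auto
    moreover have "(?t ^ a) powr (A / real a) = ?t powr A"
      using t a by (simp add: powr_powr flip: powr_realpow)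
    moreover have "(c * real n powr 2) powr (A / real a)
        = c powr (A / real a) * real n powr (2 * A / real a)"
      by (subst powr_mult) (use c in \<open>auto simp: powr_powr simp del: powr_numeral\<close>)
    moreover have "\<dots> \<le> c powr (A / real a) * real n powr \<epsilon>"
      using a n by (intro mult_left_mono powr_mono) auto
    ultimately show ?thesis by linarith
  qed
  moreover have "c powr (A / real a) > 0" using c by simp
  ultimately show ?thesis by blast
qed

section \<open>Binary forms as coefficient vectors\<close>

text \<open>The \<open>k\<close>-th entry stands for the coefficient of \<open>t\<^sub>1\<^bsup>d - k\<^esup> t\<^sub>2\<^sup>k\<close>. Entries beyond \<open>d\<close> vanish, so
  that vectors are added pointwise.\<close>

definition coeff_box :: "nat \<Rightarrow> int \<Rightarrow> (nat \<Rightarrow> int) set" where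
  "coeff_box d h = {c. (\<forall>k. \<bar>c k\<bar> \<le> h) \<and> (\<forall>k>d. c k = 0)}"

definition form_value :: "nat \<Rightarrow> (nat \<Rightarrow> int) \<Rightarrow> int \<times> int \<Rightarrow> int" where
  "form_value d c n = (\<Sum>k\<le>d. c k * (fst n ^ (d - k) * snd n ^ k))"

definition coeff_boxes :: "('m::finite \<Rightarrow> nat) \<Rightarrow> int \<Rightarrow> ('m \<Rightarrow> nat \<Rightarrow> int) set" where
  "coeff_boxes d h = {c. \<forall>j. c j \<in> coeff_box (d j) h}"

definition form_values :: "('m::finite \<Rightarrow> nat) \<Rightarrow> ('m \<Rightarrow> nat \<Rightarrow> int) \<Rightarrow> int \<times> int \<Rightarrow> 'm \<Rightarrow> int" where
  "form_values d c n = (\<lambda>j. form_value (d j) (c j) n)"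

lemma bij_betw_coeff_box_PiE:
  assumes "h \<ge> 0"
  shows "bij_betw (\<lambda>c. restrict c {..d}) (coeff_box d h) ({..d} \<rightarrow>\<^sub>E {-h..h})"
proof (rule bij_betw_byWitness[where f' = "\<lambda>c k. if k \<le> d then c k else 0"])
  show "\<forall>c\<in>coeff_box d h. (\<lambda>k. if k \<le> d then restrict c {..d} k else 0) = c"
    by (auto simp: coeff_box_def)
  show "\<forall>c\<in>{..d} \<rightarrow>\<^sub>E {-h..h}. restrict (\<lambda>k. if k \<le> d then c k else 0) {..d} = c"
    by (auto simp: PiE_def extensional_def restrict_def)
  show "(\<lambda>c. restrict c {..d}) ` coeff_box d h \<subseteq> {..d} \<rightarrow>\<^sub>E {-h..h}"
  proof clarify
    fix c assume "c \<in> coeff_box d h"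
    then have "\<bar>c k\<bar> \<le> h" for k by (simp add: coeff_box_def)
    then have "c k \<in> {-h..h}" for k by (metis abs_le_iff atLeastAtMost_iff minus_le_iff)
    then show "restrict c {..d} \<in> {..d} \<rightarrow>\<^sub>E {-h..h}" by (simp only: restrict_PiE_iff) simp
  qed
  show "(\<lambda>c k. if k \<le> d then c k else 0) ` ({..d} \<rightarrow>\<^sub>E {-h..h}) \<subseteq> coeff_box d h"
  proof clarify
    fix c assume "c \<in> {..d} \<rightarrow>\<^sub>E {-h..h}"
    then have "c k \<in> {-h..h}" if "k \<le> d" for k using that by (auto simp: PiE_def)
    then show "(\<lambda>k. if k \<le> d then c k else 0) \<in> coeff_box d h"
      using assms by (force simp: coeff_box_def abs_le_iff)
  qed
qed

lemma finite_coeff_box: "finite (coeff_box d h)"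
proof (cases "h \<ge> 0")
  case True
  have "finite ({..d} \<rightarrow>\<^sub>E {-h..h})" by (intro finite_PiE) auto
  then show ?thesis using bij_betw_finite[OF bij_betw_coeff_box_PiE[OF True]] by blast
next
  case False
  then have "coeff_box d h = {}" by (force simp: coeff_box_def)
  then show ?thesis by simp
qed

lemma card_coeff_box:
  assumes "h \<ge> 0"
  shows "real (card (coeff_box d h)) = (2 * real_of_int h + 1) ^ (d + 1)"
proof -
  have "card (coeff_box d h) = card ({..d} \<rightarrow>\<^sub>E {-h..h})"
    by (rule bij_betw_same_card[OF bij_betw_coeff_box_PiE[OF assms]])
  then show ?thesis using assms by (simp add: card_PiE)
qed

lemma coeff_boxes_PiE: "coeff_boxes d h = (\<Pi>\<^sub>E j\<in>UNIV. coeff_box (d j) h)"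
  by (auto simp: coeff_boxes_def)

lemma finite_coeff_boxes: "finite (coeff_boxes d h)"
  unfolding coeff_boxes_PiE by (intro finite_PiE finite_coeff_box) auto

lemma card_coeff_boxes: "card (coeff_boxes d h) = (\<Prod>j\<in>UNIV. card (coeff_box (d j) h))"
  unfolding coeff_boxes_PiE by (rule card_PiE) simp

lemma card_coeff_boxes_double_le:
  assumes "h \<ge> 0"
  shows "real (card (coeff_boxes d (2 * h))) \<le> 2 ^ (\<Sum>j\<in>UNIV. d j + 1) * real (card (coeff_boxes d h))"
proof -
  have "real (card (coeff_boxes d (2 * h))) = (\<Prod>j\<in>UNIV. (2 * (2 * real_of_int h) + 1) ^ (d j + 1))"
    using card_coeff_box[of "2 * h"] assms by (simp add: card_coeff_boxes)
  also have "\<dots> \<le> (\<Prod>j\<in>UNIV. (2 * (2 * real_of_int h + 1)) ^ (d j + 1))"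
    using assms by (intro prod_mono conjI power_mono) auto
  also have "\<dots> = (\<Prod>j\<in>UNIV. 2 ^ (d j + 1) * real (card (coeff_box (d j) h)))"
    unfolding power_mult_distrib card_coeff_box[OF assms] ..
  also have "\<dots> = 2 ^ (\<Sum>j\<in>UNIV. d j + 1) * real (card (coeff_boxes d h))"
    by (simp only: prod.distrib power_sum card_coeff_boxes of_nat_prod)
  finally show ?thesis .
qed

lemma sum_prod_coeff_boxes:
  fixes g :: "'m::finite \<Rightarrow> (nat \<Rightarrow> int) \<Rightarrow> real"
  shows "(\<Sum>c\<in>coeff_boxes d h. \<Prod>j\<in>UNIV. g j (c j)) = (\<Prod>j\<in>UNIV. \<Sum>b\<in>coeff_box (d j) h. g j b)"
  unfolding coeff_boxes_PiE by (rule prod_sum_PiE[symmetric]) (auto intro: finite_coeff_box)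

definition form_of :: "nat \<Rightarrow> (nat \<Rightarrow> int) \<Rightarrow> int poly poly" where
  "form_of d c = (\<Sum>k\<le>d. monom (monom (c k) (d - k)) k)"

lemma bicoeff_form_of: "bicoeff (form_of d c) i k = (if k \<le> d \<and> i = d - k then c k else 0)"
proof -
  have "coeff (form_of d c) k = (\<Sum>k'\<le>d. if k' = k then monom (c k) (d - k) else 0)"
    unfolding form_of_def coeff_sum coeff_monom by (intro sum.cong) auto
  then show ?thesis by (auto simp: bicoeff_def)
qed

lemma bieval_form_of: "bieval (form_of d c) n = form_value d c n"
  by (simp add: bieval_def form_of_def form_value_def poly_sum poly_monom mult.assoc)

lemma form_of_bicoeff:
  assumes "binary_form d F"
  shows "form_of d (\<lambda>k. bicoeff F (d - k) k) = F"
proof -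
  have "bicoeff (form_of d (\<lambda>k. bicoeff F (d - k) k)) i k = bicoeff F i k" for i k
    using assms by (fastforce simp: bicoeff_form_of binary_form_def)
  then show ?thesis by (simp add: bicoeff_def poly_eq_iff)
qed

lemma bij_betw_coeff_boxes_forms_Z:
  assumes "H \<ge> 0"
  shows "bij_betw (\<lambda>c j. form_of (d j) (c j)) (coeff_boxes d \<lfloor>H\<rfloor>) (forms_Z d H)"
proof (rule bij_betw_byWitness[where
      f' = "\<lambda>F j k. if k \<le> d j then bicoeff (F j) (d j - k) k else 0"])
  have bounded: "real_of_int \<bar>z\<bar> \<le> H \<longleftrightarrow> \<bar>z\<bar> \<le> \<lfloor>H\<rfloor>" for z by (simp add: le_floor_iff)
  show "\<forall>c\<in>coeff_boxes d \<lfloor>H\<rfloor>.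
      (\<lambda>j k. if k \<le> d j then bicoeff (form_of (d j) (c j)) (d j - k) k else 0) = c"
    by (auto simp: bicoeff_form_of coeff_boxes_def coeff_box_def fun_eq_iff)
  have form_of_cong: "form_of (d j) (\<lambda>k. if k \<le> d j then b k else 0) = form_of (d j) b" for j b
    by (simp add: form_of_def)
  show "\<forall>F\<in>forms_Z d H.
      (\<lambda>j. form_of (d j) (\<lambda>k. if k \<le> d j then bicoeff (F j) (d j - k) k else 0)) = F"
    by (auto simp: form_of_cong forms_Z_def form_of_bicoeff)
  show "(\<lambda>c j. form_of (d j) (c j)) ` coeff_boxes d \<lfloor>H\<rfloor> \<subseteq> forms_Z d H"
    unfolding forms_Z_def bounded
    by (auto simp: binary_form_def bicoeff_form_of coeff_boxes_def coeff_box_def assms split: if_splits)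
  show "(\<lambda>F j k. if k \<le> d j then bicoeff (F j) (d j - k) k else 0) ` forms_Z d H
      \<subseteq> coeff_boxes d \<lfloor>H\<rfloor>"
    unfolding forms_Z_def bounded by (auto simp: coeff_boxes_def coeff_box_def assms)
qed

text \<open>The quantities to be averaged depend on a form only through its values, so the polynomials can be
  replaced by coefficient vectors.\<close>

lemma sum_forms_Z:
  assumes "H \<ge> 0"
  shows "(\<Sum>F\<in>forms_Z d H. g (\<lambda>n j. bieval (F j) n)) = (\<Sum>c\<in>coeff_boxes d \<lfloor>H\<rfloor>. g (form_values d c))"
proof -
  have "(\<Sum>c\<in>coeff_boxes d \<lfloor>H\<rfloor>. g (form_values d c))
      = (\<Sum>c\<in>coeff_boxes d \<lfloor>H\<rfloor>. g (\<lambda>n j. bieval (form_of (d j) (c j)) n))"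
    by (simp add: bieval_form_of form_values_def[abs_def])
  also have "\<dots> = (\<Sum>F\<in>forms_Z d H. g (\<lambda>n j. bieval (F j) n))"
    by (rule sum.reindex_bij_betw[OF bij_betw_coeff_boxes_forms_Z[OF assms]])
  finally show ?thesis ..
qed

lemma form_value_add: "form_value d (\<lambda>k. b k + c k) n = form_value d b n + form_value d c n"
  by (simp add: form_value_def distrib_right sum.distrib)

lemma form_value_smult: "form_value d (\<lambda>k. l * c k) n = l * form_value d c n"
  by (simp add: form_value_def sum_distrib_left mult.assoc)

lemma form_value_scaled_point: "form_value d c (g * u, g * v) = g ^ d * form_value d c (u, v)"
  unfolding form_value_def sum_distrib_left
proof (rule sum.cong)
  fix k assume "k \<in> {..d}"
  then have "g ^ d = g ^ (d - k) * g ^ k" by (simp flip: power_add)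
  then show "c k * (fst (g * u, g * v) ^ (d - k) * snd (g * u, g * v) ^ k)
      = g ^ d * (c k * (fst (u, v) ^ (d - k) * snd (u, v) ^ k))"
    by (simp add: power_mult_distrib)
qed simp

text \<open>Changing only the two extreme coefficients moves the value by combinations of \<open>u\<^sup>d\<close> and \<open>v\<^sup>d\<close>,
  which are coprime at a primitive point.\<close>

lemma form_value_end_coeffs:
  "form_value d (\<lambda>k. (if k = 0 then i else 0) + (if k = d then j else 0)) (u, v)
     = i * u ^ d + j * v ^ d"
proof -
  have "(if k = 0 then i else 0) * (u ^ (d - k) * v ^ k) = (if k = 0 then i * u ^ d else 0)" for k
    by simp
  moreover have "(if k = d then j else 0) * (u ^ (d - k) * v ^ k) = (if k = d then j * v ^ d else 0)" for k
    by simp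
  ultimately show ?thesis
    unfolding form_value_add by (simp add: form_value_def sum.delta)
qed

lemma abs_form_value_le:
  assumes "c \<in> coeff_box d h" "\<bar>u\<bar> \<le> X" "\<bar>v\<bar> \<le> X"
  shows "\<bar>form_value d c (u, v)\<bar> \<le> (int d + 1) * (h * X ^ d)"
proof -
  have "\<bar>form_value d c (u, v)\<bar> \<le> (\<Sum>k\<le>d. \<bar>c k * (u ^ (d - k) * v ^ k)\<bar>)"
    unfolding form_value_def by (metis (no_types, lifting) fst_conv snd_conv sum.cong sum_abs)
  also have "\<dots> \<le> (\<Sum>k\<le>d. h * X ^ d)"
  proof (rule sum_mono)
    fix k assume "k \<in> {..d}"
    have "\<bar>u\<bar> ^ (d - k) * \<bar>v\<bar> ^ k \<le> X ^ (d - k) * X ^ k"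
      using assms by (intro mult_mono power_mono) auto
    also have "\<dots> = X ^ d" using \<open>k \<in> {..d}\<close> by (simp flip: power_add)
    finally show "\<bar>c k * (u ^ (d - k) * v ^ k)\<bar> \<le> h * X ^ d"
      unfolding abs_mult power_abs using assms(1)
      by (intro mult_mono) (auto simp: coeff_box_def intro: order_trans[of 0 "\<bar>c 0\<bar>"])
  qed
  finally show ?thesis by (simp add: algebra_simps)
qed

section \<open>The second moment at a single point\<close>

text \<open>A vector whose value is divisible by \<open>e\<close> has \<open>e\<close> translates, one for each residue modulo \<open>e\<close>, in a
  slightly larger box. The residue reached by a translate determines the translation, so all
  translates of all such vectors are different.\<close>

lemma card_form_value_dvd_le:
  assumes "coprime u v" "d \<ge> 1" "e \<ge> 1"
  shows "e * card {c \<in> coeff_box d h. int e dvd form_value d c (u, v)}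
    \<le> card (coeff_box d (h + int e))"
proof -
  let ?T = "{c \<in> coeff_box d h. int e dvd form_value d c (u, v)}"
  have "coprime (u ^ d) (v ^ d)" using assms by simp
  then obtain \<alpha> \<beta> where bez: "\<alpha> * u ^ d + \<beta> * v ^ d = 1"
    using bezout_int[of "u ^ d" "v ^ d"] by auto
  \<comment> \<open>Bezout coefficients may be large, but only their multiples modulo \<open>e\<close> matter.\<close>
  define w :: "nat \<Rightarrow> nat \<Rightarrow> int" where
    "w k = (\<lambda>i. (if i = 0 then (int k * \<alpha>) mod int e else 0)
              + (if i = d then (int k * \<beta>) mod int e else 0))" for k
  let ?\<phi> = "\<lambda>(k, c) i. c i + w k i"
  have w_value: "form_value d (?\<phi> (k, c)) (u, v) mod int e = int k"
    if "k < e" "c \<in> ?T" for k c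
  proof -
    have "form_value d (w k) (u, v) mod int e
        = ((int k * \<alpha>) mod int e * u ^ d + (int k * \<beta>) mod int e * v ^ d) mod int e"
      unfolding w_def form_value_end_coeffs ..
    also have "\<dots> = (int k * \<alpha> * u ^ d + int k * \<beta> * v ^ d) mod int e"
      by (metis mod_add_cong mod_mult_left_eq)
    also have "\<dots> = int k * (\<alpha> * u ^ d + \<beta> * v ^ d) mod int e"
      by (simp add: algebra_simps)
    finally have "form_value d (w k) (u, v) mod int e = int k"
      using that by (simp add: bez)
    then show ?thesis
      using that by (simp add: form_value_add mod_add_eq[symmetric] del: mod_add_eq)
  qed
  have "inj_on ?\<phi> ({..<e} \<times> ?T)"
  proof (rule inj_onI)
    fix p q
    assume pq: "p \<in> {..<e} \<times> ?T" "q \<in> {..<e} \<times> ?T" "?\<phi> p = ?\<phi> q"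
    obtain k c l b where eq: "p = (k, c)" "q = (l, b)" by (cases p, cases q) auto
    then have *: "k < e" "c \<in> ?T" "l < e" "b \<in> ?T" "?\<phi> (k, c) = ?\<phi> (l, b)"
      using pq by auto
    then have "k = l" by (metis (no_types, lifting) w_value of_nat_eq_iff)
    moreover from this have "c i = b i" for i using fun_cong[OF *(5), of i] by simp
    ultimately show "p = q" by (auto simp: eq)
  qed
  moreover have "?\<phi> ` ({..<e} \<times> ?T) \<subseteq> coeff_box d (h + int e)"
  proof clarify
    fix k c assume k: "k < e" and c: "c \<in> coeff_box d h"
    have "0 \<le> w k i \<and> w k i \<le> int e" for i
      using assms by (auto simp: w_def intro: order.strict_implies_order)
    moreover have "\<bar>c i\<bar> \<le> h" for i using c by (simp add: coeff_box_def)
    ultimately have "\<bar>c i + w k i\<bar> \<le> h + int e" for i by (smt (verit))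
    then show "(\<lambda>i. c i + w k i) \<in> coeff_box d (h + int e)"
      using c by (auto simp: coeff_box_def w_def)
  qed
  ultimately have "card ({..<e} \<times> ?T) \<le> card (coeff_box d (h + int e))"
    using finite_coeff_box card_inj_on_le by blast
  then show ?thesis by (simp add: card_cartesian_product)
qed

text \<open>With \<open>Y = (d + 2) h\<close> every value is below \<open>Y\<^bsup>d + 1\<^esup>\<close>, and yet \<open>e \<le> Y\<close> is small enough for
  the enlarged box of the preceding count to have a size comparable with the original one.\<close>

lemma tau_weight_sum_primitive_le:
  assumes "coprime u v" "d \<ge> 1" "\<bar>u\<bar> \<le> h" "\<bar>v\<bar> \<le> h" "h \<ge> 1"
    and A: "A \<ge> 0" "2 * (real d + 1) * A \<le> real b"
  shows "(\<Sum>c\<in>coeff_box d h. tau_weight A (form_value d c (u, v)))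
    \<le> 2 ^ b * (real d + 3) ^ (d + 1) * (1 + ln ((real d + 2) * h)) ^ (2 ^ b)
        * real (card (coeff_box d h))"
proof -
  define Y where "Y = nat ((int d + 2) * h)"
  have "1 * 1 \<le> (int d + 2) * h" using assms by (intro mult_mono) auto
  then have Y: "int Y = (int d + 2) * h" "Y \<ge> 1" by (auto simp: Y_def le_nat_iff)
  then have Y_real: "real Y = (real d + 2) * real_of_int h"
    by (metis of_int_add of_int_mult of_int_numeral of_int_of_nat_eq)
  let ?T = "\<lambda>e. {c \<in> coeff_box d h. int e dvd form_value d c (u, v)}"
  let ?V = "real (card (coeff_box d h))"
  have small: "\<bar>form_value d c (u, v)\<bar> < int (Y ^ (d + 1))" if "c \<in> coeff_box d h" for c
  proof -
    have "\<bar>form_value d c (u, v)\<bar> \<le> (int d + 1) * (h * h ^ d)"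
      using that assms by (intro abs_form_value_le) auto
    also have "\<dots> < (int d + 2) * (h * h ^ d)"
      using assms by (intro mult_strict_right_mono) auto
    also have "\<dots> \<le> (int d + 2) ^ (d + 1) * h ^ (d + 1)"
      using assms self_le_power[of "int d + 2" "d + 1"] by (simp add: mult_right_mono)
    also have "\<dots> = int (Y ^ (d + 1))"
      unfolding of_nat_power Y(1) power_mult_distrib ..
    finally show ?thesis .
  qed
  have count: "real (card (?T e)) \<le> (real d + 3) ^ (d + 1) * ?V / real e" if "e \<in> {1..Y}" for e
  proof -
    have "real e * real (card (?T e)) \<le> real (card (coeff_box d (h + int e)))"
      unfolding of_nat_mult[symmetric] of_nat_le_iff
      using assms that by (intro card_form_value_dvd_le) auto
    also have "\<dots> = (2 * (real_of_int h + real e) + 1) ^ (d + 1)"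
      using assms by (subst card_coeff_box) auto
    also have "\<dots> \<le> ((real d + 3) * (2 * real_of_int h + 1)) ^ (d + 1)"
    proof (rule power_mono)
      have "real e \<le> (real d + 2) * real_of_int h" using that Y_real by simp
      then show "2 * (real_of_int h + real e) + 1 \<le> (real d + 3) * (2 * real_of_int h + 1)"
        by (simp add: algebra_simps)
    qed (use assms in auto)
    also have "\<dots> = (real d + 3) ^ (d + 1) * ?V"
      using assms by (simp add: card_coeff_box power_mult_distrib)
    finally show ?thesis using that by (simp add: field_simps)
  qed
  have "(\<Sum>c\<in>coeff_box d h. tau_weight A (form_value d c (u, v)))
      \<le> (\<Sum>c\<in>coeff_box d h. 2 ^ b *
          (\<Sum>e | e \<in> {1..Y} \<and> int e dvd form_value d c (u, v). real (divisor_tau e) ^ b))"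
    using small A Y by (intro sum_mono tau_weight_le_sum_divisors[where K = "d + 1"]) (auto simp: add.commute)
  also have "\<dots> = 2 ^ b * (\<Sum>e=1..Y. \<Sum>c\<in>?T e. real (divisor_tau e) ^ b)"
    unfolding sum_distrib_left[symmetric]
    using sum.swap_restrict[OF finite_coeff_box finite_atLeastAtMost,
        where g = "\<lambda>c e. real (divisor_tau e) ^ b" and R = "\<lambda>c e. int e dvd form_value d c (u, v)"]
    by simp
  also have "\<dots> = 2 ^ b * (\<Sum>e=1..Y. real (divisor_tau e) ^ b * real (card (?T e)))"
    by (simp add: mult.commute)
  also have "\<dots> \<le> 2 ^ b * (\<Sum>e=1..Y. real (divisor_tau e) ^ b * ((real d + 3) ^ (d + 1) * ?V / real e))"
    using count by (intro mult_left_mono sum_mono) auto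
  also have "\<dots> = 2 ^ b * (real d + 3) ^ (d + 1) * (\<Sum>e=1..Y. real (divisor_tau e) ^ b / real e) * ?V"
    by (simp add: sum_distrib_left sum_distrib_right field_simps)
  also have "\<dots> \<le> 2 ^ b * (real d + 3) ^ (d + 1) * (1 + ln (real Y)) ^ (2 ^ b) * ?V"
  proof (intro mult_right_mono mult_left_mono)
    have "harm Y ^ 2 ^ b \<le> (1 + ln (real Y)) ^ 2 ^ b"
      using Y(2) by (intro power_mono harm_le_one_plus_ln harm_nonneg)
    then show "(\<Sum>e=1..Y. real (divisor_tau e) ^ b / real e) \<le> (1 + ln (real Y)) ^ (2 ^ b)"
      using divisor_tau_moment_le[of b Y] by linarith
  qed auto
  finally show ?thesis by (simp only: Y_real)
qed

text \<open>The value at \<open>n = g (u, v)\<close> is \<open>g\<^sup>d\<close> times the value at the primitive point \<open>(u, v)\<close>.\<close>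

lemma tau_weight_sum_le:
  assumes "n \<noteq> (0, 0)" "d \<ge> 1" "\<bar>fst n\<bar> \<le> h" "\<bar>snd n\<bar> \<le> h" "h \<ge> 1"
    and A: "A \<ge> 0" "2 * (real d + 1) * A \<le> real b"
  shows "(\<Sum>c\<in>coeff_box d h. tau_weight A (form_value d c n))
    \<le> real (divisor_tau (nat (gcd (fst n) (snd n)))) powr (A * real d) *
       (2 ^ b * (real d + 3) ^ (d + 1) * (1 + ln ((real d + 2) * h)) ^ (2 ^ b))
        * real (card (coeff_box d h))"
proof -
  define g where "g = nat (gcd (fst n) (snd n))"
  have "gcd (fst n) (snd n) \<noteq> 0" using assms(1) by (cases n) auto
  then have g: "int g = gcd (fst n) (snd n)" "g > 0" by (auto simp: g_def)
  obtain u v where uv: "fst n = u * int g" "snd n = v * int g" "coprime u v"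
    using gcd_coprime_exists[of "fst n" "snd n"] \<open>gcd (fst n) (snd n) \<noteq> 0\<close> g(1) by metis
  have n: "n = (int g * u, int g * v)" using uv by (cases n) (simp add: mult.commute)
  have "\<bar>u\<bar> \<le> \<bar>fst n\<bar>" "\<bar>v\<bar> \<le> \<bar>snd n\<bar>"
    using uv g(2) mult_left_mono[of 1 "int g" "\<bar>u\<bar>"] mult_left_mono[of 1 "int g" "\<bar>v\<bar>"]
    by (auto simp: abs_mult)
  then have uv_le: "\<bar>u\<bar> \<le> h" "\<bar>v\<bar> \<le> h" using assms by auto
  have t: "real (divisor_tau (g ^ d)) powr A \<le> real (divisor_tau g) powr (A * real d)"
  proof -
    have "real (divisor_tau (g ^ d)) powr A \<le> real (divisor_tau g ^ d) powr A"
      using divisor_tau_power_le[OF g(2), of d] A by (intro powr_mono2 of_nat_mono) auto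
    also have "\<dots> = (real (divisor_tau g) powr real d) powr A"
      using divisor_tau_ge_1[OF g(2)] by (simp add: powr_realpow)
    finally show ?thesis by (simp add: powr_powr mult.commute)
  qed
  have "tau_weight A (form_value d c n)
      \<le> real (divisor_tau g) powr (A * real d) * tau_weight A (form_value d c (u, v))" for c
  proof -
    have "tau_weight A (form_value d c n) = tau_weight A (int (g ^ d) * form_value d c (u, v))"
      unfolding n by (simp add: form_value_scaled_point)
    also have "\<dots> \<le> real (divisor_tau (g ^ d)) powr A * tau_weight A (form_value d c (u, v))"
      using A g by (intro tau_weight_mult_le) auto
    also have "\<dots> \<le> real (divisor_tau g) powr (A * real d) * tau_weight A (form_value d c (u, v))"
      using t by (intro mult_right_mono tau_weight_ge_0)
    finally show ?thesis .
  qed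
  then have "(\<Sum>c\<in>coeff_box d h. tau_weight A (form_value d c n))
      \<le> real (divisor_tau g) powr (A * real d) *
          (\<Sum>c\<in>coeff_box d h. tau_weight A (form_value d c (u, v)))"
    unfolding sum_distrib_left by (intro sum_mono)
  also have "\<dots> \<le> real (divisor_tau g) powr (A * real d) *
       (2 ^ b * (real d + 3) ^ (d + 1) * (1 + ln ((real d + 2) * h)) ^ (2 ^ b)
        * real (card (coeff_box d h)))"
    using uv uv_le assms by (intro mult_left_mono tau_weight_sum_primitive_le) auto
  finally show ?thesis by (simp add: g_def mult.assoc)
qed

lemma cmod_power2_le_tau_weight:
  fixes f :: "('m::finite \<Rightarrow> int) \<Rightarrow> complex"
  assumes "\<And>n. cmod (f n) \<le> B * (\<Prod>j\<in>{j. n j \<noteq> 0}. real (divisor_tau (nat \<bar>n j\<bar>)) powr C)"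
  shows "(cmod (f t))\<^sup>2 \<le> B\<^sup>2 * (\<Prod>j\<in>UNIV. tau_weight (2 * C) (t j))"
proof -
  have "(\<Prod>j\<in>{j. t j \<noteq> 0}. real (divisor_tau (nat \<bar>t j\<bar>)) powr C) = (\<Prod>j\<in>UNIV. tau_weight C (t j))"
    by (rule prod.mono_neutral_cong_left) (auto simp: tau_weight_def)
  then have "(cmod (f t))\<^sup>2 \<le> (B * (\<Prod>j\<in>UNIV. tau_weight C (t j)))\<^sup>2"
    using assms[of t] by (intro power_mono) auto
  also have "\<dots> = B\<^sup>2 * (\<Prod>j\<in>UNIV. (tau_weight C (t j))\<^sup>2)"
    by (simp add: power_mult_distrib prod_power_distrib)
  finally show ?thesis
    by (simp only: tau_weight_square)
qed

text \<open>The coordinates of a vector of forms vary independently, so the sum factors into sums over the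
  single forms.\<close>

lemma second_moment_le:
  fixes f :: "('m::finite \<Rightarrow> int) \<Rightarrow> complex" and d b :: "'m \<Rightarrow> nat"
  assumes f: "\<And>n. cmod (f n) \<le> B * (\<Prod>j\<in>{j. n j \<noteq> 0}. real (divisor_tau (nat \<bar>n j\<bar>)) powr C)"
    and d: "\<And>j. d j \<ge> 1" and C: "C \<ge> 0"
    and b: "\<And>j. 4 * C * (real (d j) + 1) \<le> real (b j)"
    and n: "n \<noteq> (0, 0)" "\<bar>fst n\<bar> \<le> h" "\<bar>snd n\<bar> \<le> h"
  shows "(\<Sum>c\<in>coeff_boxes d h. (cmod (f (form_values d c n)))\<^sup>2)
    \<le> B\<^sup>2 * real (divisor_tau (nat (gcd (fst n) (snd n)))) powr (2 * C * real (\<Sum>j\<in>UNIV. d j)) *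
      (\<Prod>j\<in>UNIV. 2 ^ b j * (real (d j) + 3) ^ (d j + 1) * (1 + ln ((real (d j) + 2) * h)) ^ (2 ^ b j)) *
      real (card (coeff_boxes d h))"
proof -
  have h: "h \<ge> 1" using n by (cases n) (auto simp: abs_if split: if_splits)
  let ?t = "real (divisor_tau (nat (gcd (fst n) (snd n))))"
  let ?K = "\<lambda>j. 2 ^ b j * (real (d j) + 3) ^ (d j + 1) * (1 + ln ((real (d j) + 2) * h)) ^ (2 ^ b j)"
  have "(\<Sum>c\<in>coeff_boxes d h. (cmod (f (form_values d c n)))\<^sup>2)
      \<le> (\<Sum>c\<in>coeff_boxes d h. B\<^sup>2 * (\<Prod>j\<in>UNIV. tau_weight (2 * C) (form_value (d j) (c j) n)))"
    unfolding form_values_def by (intro sum_mono cmod_power2_le_tau_weight f)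
  also have "\<dots> = B\<^sup>2 * (\<Prod>j\<in>UNIV. \<Sum>c\<in>coeff_box (d j) h. tau_weight (2 * C) (form_value (d j) c n))"
    using sum_prod_coeff_boxes[of "\<lambda>j c. tau_weight (2 * C) (form_value (d j) c n)" d h]
    by (simp flip: sum_distrib_left)
  also have "\<dots> \<le> B\<^sup>2 * (\<Prod>j\<in>UNIV. ?t powr (2 * C * real (d j)) * ?K j * real (card (coeff_box (d j) h)))"
  proof (intro mult_left_mono prod_mono conjI)
    fix j
    show "(\<Sum>c\<in>coeff_box (d j) h. tau_weight (2 * C) (form_value (d j) c n))
        \<le> ?t powr (2 * C * real (d j)) * ?K j * real (card (coeff_box (d j) h))"
      using n d h C b[of j] by (intro tau_weight_sum_le) (auto simp: algebra_simps)
  qed (auto intro: sum_nonneg tau_weight_ge_0)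
  also have "\<dots> = B\<^sup>2 * (\<Prod>j\<in>UNIV. ?t powr (2 * C * real (d j))) * (\<Prod>j\<in>UNIV. ?K j)
      * real (card (coeff_boxes d h))"
    by (simp add: prod.distrib card_coeff_boxes)
  also have "(\<Prod>j\<in>UNIV. ?t powr (2 * C * real (d j))) = ?t powr (2 * C * real (\<Sum>j\<in>UNIV. d j))"
  proof -
    have "gcd (fst n) (snd n) \<noteq> 0" using n(1) by (cases n) auto
    then have "gcd (fst n) (snd n) > 0" by (simp only: order_less_le) simp
    then have "divisor_tau (nat (gcd (fst n) (snd n))) \<ge> 1"
      by (intro divisor_tau_ge_1) simp
    then show ?thesis by (simp add: powr_sum[symmetric] sum_distrib_left)
  qed
  finally show ?thesis .
qed

section \<open>Sums over boxes in residue classes\<close>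

lemma finite_int_box: "finite {t :: 'm::finite \<Rightarrow> int. \<forall>k. a k \<le> real_of_int (t k) \<and> real_of_int (t k) \<le> b k}"
proof (rule finite_subset)
  show "{t. \<forall>k. a k \<le> real_of_int (t k) \<and> real_of_int (t k) \<le> b k}
      \<subseteq> (\<Pi>\<^sub>E k\<in>UNIV. {\<lceil>a k\<rceil>..\<lfloor>b k\<rfloor>})"
    by (auto simp: PiE_def ceiling_le_iff le_floor_iff)
  show "finite (\<Pi>\<^sub>E k\<in>(UNIV :: 'm set). {\<lceil>a k\<rceil>..\<lfloor>b k\<rfloor>})"
    by (intro finite_PiE) auto
qed

lemma finite_residue_vectors:
  fixes q :: "'m::finite \<Rightarrow> int"
  shows "finite {r. \<forall>j. r j \<in> {0..<\<bar>q j\<bar>}}"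
proof -
  have "{r. \<forall>j. r j \<in> {0..<\<bar>q j\<bar>}} = (\<Pi>\<^sub>E j\<in>UNIV. {0..<\<bar>q j\<bar>})" by (auto simp: PiE_def)
  then show ?thesis by (simp add: finite_PiE)
qed

text \<open>The residues \<open>r\<close> are arbitrary integers here, and the moduli may be negative; both are reduced to
  the representatives used in the definition of the error.\<close>

lemma initial_sum_le_equidist_error:
  fixes f :: "('m::finite \<Rightarrow> int) \<Rightarrow> complex" and r q :: "'m \<Rightarrow> int"
  assumes "\<And>k. \<bar>v k\<bar> \<le> x k" "\<And>k. q k \<noteq> 0"
  shows "cmod (\<Sum>t | \<forall>k. - x k \<le> real_of_int (t k) \<and> real_of_int (t k) \<le> v k \<and> [t k = r k] (mod q k). f t)
    \<le> equidist_error f x q"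
proof -
  let ?S = "\<lambda>r v. {t. \<forall>k. - x k \<le> real_of_int (t k) \<and> real_of_int (t k) \<le> v k \<and> [t k = r k] (mod q k)}"
  define s where "s = (\<lambda>k. r k mod \<bar>q k\<bar>)"
  have s: "s \<in> {r. \<forall>j. r j \<in> {0..<\<bar>q j\<bar>}}" using assms(2) by (simp add: s_def)
  have "[s k = r k] (mod q k)" for k
    by (metis cong_abs cong_mod_left cong_refl s_def)
  then have "[t k = r k] (mod q k) \<longleftrightarrow> [t k = s k] (mod q k)" for t :: "'m \<Rightarrow> int" and k
    by (meson cong_sym cong_trans)
  then have "?S r v = ?S s v" by simp
  moreover have "cmod (sum f (?S s v)) \<le> (SUP v\<in>{v. \<forall>k. \<bar>v k\<bar> \<le> x k}. cmod (sum f (?S s v)))"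
  proof (rule cSUP_upper)
    let ?M = "\<Sum>t | \<forall>k. - x k \<le> real_of_int (t k) \<and> real_of_int (t k) \<le> x k. cmod (f t)"
    have "cmod (sum f (?S s v)) \<le> ?M" if "\<forall>k. \<bar>v k\<bar> \<le> x k" for v
    proof -
      have "?S s v \<subseteq> {t. \<forall>k. - x k \<le> real_of_int (t k) \<and> real_of_int (t k) \<le> x k}"
        using that by clarify (meson abs_le_D1 order_trans)
      then have "(\<Sum>t\<in>?S s v. cmod (f t)) \<le> ?M"
        by (intro sum_mono2 finite_int_box) auto
      then show ?thesis using norm_sum order_trans by blast
    qed
    then show "bdd_above ((\<lambda>v. cmod (sum f (?S s v))) ` {v. \<forall>k. \<bar>v k\<bar> \<le> x k})"
      by (intro bdd_aboveI[of _ ?M]) auto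
  qed (use assms in auto)
  also have "\<dots> \<le> equidist_error f x q"
    unfolding equidist_error_def
    using s by (intro Max_ge finite_imageI finite_residue_vectors) auto
  ultimately show ?thesis by simp
qed

lemma equidist_error_nonneg:
  fixes f :: "('m::finite \<Rightarrow> int) \<Rightarrow> complex"
  assumes "\<And>k. 0 \<le> x k" "\<And>k. q k \<noteq> 0"
  shows "0 \<le> equidist_error f x q"
  by (rule order_trans[OF norm_ge_zero initial_sum_le_equidist_error[where v = x and r = q]])
     (use assms in auto)

text \<open>Induction on the set \<open>J\<close> of coordinates that are bounded below by \<open>u\<close>: a bound in one more
  coordinate makes the sum a difference of two sums with fewer bounds. The upper corner \<open>v\<close> of such a
  sum may lie outside the range of the supremum, but then the sum is empty.\<close>

lemma half_open_box_sum_le: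
  fixes f :: "('m::finite \<Rightarrow> int) \<Rightarrow> complex" and r q :: "'m \<Rightarrow> int"
  assumes "finite J" "\<And>k. v k \<le> x k" "\<And>k. 0 \<le> x k" "\<And>k. q k \<noteq> 0"
  shows "cmod (\<Sum>t | \<forall>k. - x k \<le> real_of_int (t k) \<and> real_of_int (t k) \<le> v k \<and>
             [t k = r k] (mod q k) \<and> (k \<in> J \<longrightarrow> u k < real_of_int (t k)). f t)
    \<le> 2 ^ card J * equidist_error f x q"
  using assms
proof (induction J arbitrary: v)
  case empty
  show ?case
  proof (cases "\<forall>k. - x k \<le> v k")
    case True
    have "\<bar>v k\<bar> \<le> x k" for k using empty(1)[of k] True by (auto simp: abs_le_iff minus_le_iff)
    then show ?thesis using initial_sum_le_equidist_error[where f = f and x = x and v = v and q = q and r = r] empty by simp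
  next
    case False
    then obtain k where k: "v k < - x k" by (auto simp: not_le)
    have nonneg: "0 \<le> equidist_error f x q"
      using empty by (intro equidist_error_nonneg)
    have "{t. \<forall>k. - x k \<le> real_of_int (t k) \<and> real_of_int (t k) \<le> v k \<and>
             [t k = r k] (mod q k) \<and> (k \<in> {} \<longrightarrow> u k < real_of_int (t k))} = {}"
      using k by (auto simp: not_le intro!: exI[of _ k])
    then show ?thesis using nonneg by (simp only: sum.empty) simp
  qed
next
  case (insert i J)
  let ?R = "\<lambda>J v. {t. \<forall>k. - x k \<le> real_of_int (t k) \<and> real_of_int (t k) \<le> v k \<and>
             [t k = r k] (mod q k) \<and> (k \<in> J \<longrightarrow> u k < real_of_int (t k))}"
  define w where "w = v(i := min (u i) (v i))"
  have w: "w k \<le> x k" for k using insert.prems(1) by (auto simp: w_def intro: min.coboundedI2)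
  have fin: "finite (?R J v)"
    by (rule finite_subset[OF _ finite_int_box[of "\<lambda>k. - x k" v]]) auto
  have w_le: "w k \<le> v k" for k by (simp add: w_def)
  have sub: "?R J w \<subseteq> ?R J v" using w_le order_trans by blast
  have "t \<in> ?R J w \<longleftrightarrow> real_of_int (t i) \<le> u i" if t: "t \<in> ?R J v" for t
  proof
    assume "t \<in> ?R J w"
    then have "real_of_int (t i) \<le> w i" by blast
    then show "real_of_int (t i) \<le> u i" by (simp add: w_def)
  next
    assume "real_of_int (t i) \<le> u i"
    moreover have "real_of_int (t k) \<le> v k" for k using t by blast
    ultimately have "real_of_int (t k) \<le> w k" for k by (simp add: w_def)
    then show "t \<in> ?R J w" using t by blast
  qed
  moreover have "t \<in> ?R (insert i J) v \<longleftrightarrow> t \<in> ?R J v \<and> \<not> real_of_int (t i) \<le> u i" for t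
    by (auto simp: not_le)
  ultimately have split: "?R (insert i J) v = ?R J v - ?R J w" by blast
  have bound_v: "cmod (sum f (?R J v)) \<le> 2 ^ card J * equidist_error f x q"
    by (rule insert.IH) (fact insert.prems)+
  have bound_w: "cmod (sum f (?R J w)) \<le> 2 ^ card J * equidist_error f x q"
    by (rule insert.IH) (fact w insert.prems)+
  have diff: "sum f (?R (insert i J) v) = sum f (?R J v) - sum f (?R J w)"
    
    unfolding split by (rule sum_diff[OF fin sub])
  have "cmod (sum f (?R (insert i J) v)) \<le> cmod (sum f (?R J v)) + cmod (sum f (?R J w))"
    unfolding diff by (rule norm_triangle_ineq4)
  also have "\<dots> \<le> 2 ^ card J * equidist_error f x q + 2 ^ card J * equidist_error f x q"
    by (rule add_mono[OF bound_v bound_w])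
  also have "\<dots> = 2 ^ card (insert i J) * equidist_error f x q"
    using insert.hyps by simp
  finally show ?case .
qed

lemma ap_box_sum_le_equidist_error:
  fixes f :: "('m::finite \<Rightarrow> int) \<Rightarrow> complex" and r q lo hi :: "'m \<Rightarrow> int"
  assumes "\<And>k. - x k \<le> real_of_int (lo k)" "\<And>k. real_of_int (hi k) \<le> x k"
    "\<And>k. 0 \<le> x k" "\<And>k. q k \<noteq> 0"
  shows "cmod (\<Sum>t | \<forall>k. lo k \<le> t k \<and> t k \<le> hi k \<and> [t k = r k] (mod q k). f t)
    \<le> 2 ^ CARD('m) * equidist_error f x q"
proof -
  have "lo k \<le> t k \<longleftrightarrow> - x k \<le> real_of_int (t k) \<and> real_of_int (lo k - 1) < real_of_int (t k)"
    for t :: "'m \<Rightarrow> int" and k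
    using assms(1)[of k] by (simp only: of_int_less_iff) force
  then have "{t. \<forall>k. lo k \<le> t k \<and> t k \<le> hi k \<and> [t k = r k] (mod q k)}
      = {t. \<forall>k. - x k \<le> real_of_int (t k) \<and> real_of_int (t k) \<le> real_of_int (hi k) \<and>
             [t k = r k] (mod q k) \<and> (k \<in> UNIV \<longrightarrow> real_of_int (lo k - 1) < real_of_int (t k))}"
    by (simp only: of_int_le_iff) blast
  then show ?thesis
    using half_open_box_sum_le[where J = UNIV and v = "\<lambda>k. real_of_int (hi k)" and x = x and q = q
        and r = r and u = "\<lambda>k. real_of_int (lo k - 1)" and f = f]
      assms by simp
qed

section \<open>Lines of forms with a constant value at one point\<close>

text \<open>A normal form for vectors modulo integer multiples of \<open>P \<noteq> 0\<close>: the entry at some fixed position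
  with \<open>P i \<noteq> 0\<close> is reduced modulo \<open>P i\<close>. Two vectors have the same root if and only if they lie on
  the same line in direction \<open>P\<close>. The root itself may lie outside the box.\<close>

definition line_root :: "(nat \<Rightarrow> int) \<Rightarrow> (nat \<Rightarrow> int) \<Rightarrow> nat \<Rightarrow> int" where
  "line_root P c = (let i = (SOME i. P i \<noteq> 0) in (\<lambda>k. c k - (c i div P i) * P k))"

definition line_roots :: "('m \<Rightarrow> nat \<Rightarrow> int) \<Rightarrow> ('m \<Rightarrow> nat \<Rightarrow> int) \<Rightarrow> 'm \<Rightarrow> nat \<Rightarrow> int" where
  "line_roots P c = (\<lambda>j. line_root (P j) (c j))"

lemma line_root_shift:
  assumes "P \<noteq> (\<lambda>_. 0)"
  shows "line_root P (\<lambda>k. c k + l * P k) = line_root P c"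
proof -
  have "P (SOME i. P i \<noteq> 0) \<noteq> 0" by (rule someI_ex) (use assms in auto)
  then show ?thesis by (simp add: line_root_def Let_def algebra_simps)
qed

lemma line_root_eqD:
  assumes "line_root P c = line_root P b"
  obtains l where "b = (\<lambda>k. c k + l * P k)"
proof -
  define i where "i = (SOME i. P i \<noteq> 0)"
  have "c k - (c i div P i) * P k = b k - (b i div P i) * P k" for k
    using fun_cong[OF assms, of k] by (simp add: line_root_def Let_def i_def)
  then have "b k = c k + (b i div P i - c i div P i) * P k" for k
    by (simp add: algebra_simps)
  then show ?thesis using that by blast
qed

lemma line_root_shift_self: "\<exists>l. line_root P c = (\<lambda>k. c k + l * P k)"
  by (rule exI[of _ "- (c (SOME i. P i \<noteq> 0) div P (SOME i. P i \<noteq> 0))"])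
     (simp add: line_root_def Let_def)

text \<open>Convexity of the box along a line, in one coordinate.\<close>

lemma abs_add_mult_le_between:
  fixes a p h l m :: int
  assumes "\<bar>a\<bar> \<le> h" "\<bar>a + m * p\<bar> \<le> h" "0 \<le> l \<and> l \<le> m \<or> m \<le> l \<and> l \<le> 0"
  shows "\<bar>a + l * p\<bar> \<le> h"
proof -
  have "0 \<le> l * p \<and> l * p \<le> m * p \<or> m * p \<le> l * p \<and> l * p \<le> 0"
    using assms(3) by (cases "p \<ge> 0")
      (auto intro: mult_right_mono mult_right_mono_neg mult_nonneg_nonneg mult_nonpos_nonneg
        mult_nonneg_nonpos mult_nonpos_nonpos)
  then show ?thesis using assms by linarith
qed

text \<open>Moving one step along the line changes the value by \<open>q\<close>, and the box is convex. Hence no member of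
  the residue class between the least and the greatest value is missed.\<close>

lemma line_values_in_box:
  fixes P c\<^sub>0 :: "nat \<Rightarrow> int" and n :: "int \<times> int"
  assumes "c\<^sub>0 \<in> coeff_box d h" "\<And>k. k > d \<Longrightarrow> P k = 0"
  defines "val \<equiv> \<lambda>c. form_value d c n" and "q \<equiv> form_value d P n" and "fib \<equiv> {c \<in> coeff_box d h. line_root P c = line_root P c\<^sub>0}"
  assumes q: "q \<noteq> 0"
  shows "inj_on val fib"
    and "\<exists>lo hi. lo \<in> val ` fib \<and> hi \<in> val ` fib \<and>
           val ` fib = {t. lo \<le> t \<and> t \<le> hi \<and> [t = form_value d c\<^sub>0 n] (mod q)}"
proof -
  have "form_value d (\<lambda>_. 0) n = 0" by (simp add: form_value_def)
  then have P: "P \<noteq> (\<lambda>_. 0)" using q by (auto simp: q_def)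
  have shift: "form_value d (\<lambda>k. c k + l * P k) n = form_value d c n + l * q" for c l
    by (simp add: form_value_add form_value_smult q_def)
  show "inj_on val fib"
  proof (rule inj_onI)
    fix c b assume *: "c \<in> fib" "b \<in> fib" "val c = val b"
    then have "line_root P c = line_root P b" by (simp add: fib_def)
    then obtain l where l: "b = (\<lambda>k. c k + l * P k)" by (rule line_root_eqD)
    then have "l * q = 0" using * shift by (simp add: val_def)
    then show "c = b" using q l by simp
  qed
  define lo hi where "lo = Min (val ` fib)" and "hi = Max (val ` fib)"
  have fin: "finite (val ` fib)" and ne: "val ` fib \<noteq> {}"
    using assms(1) finite_coeff_box by (auto simp: fib_def)
  then have mem: "lo \<in> val ` fib" "hi \<in> val ` fib"
    unfolding lo_def hi_def by (auto intro: Min_in Max_in)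
  have congr: "[form_value d c n = form_value d c\<^sub>0 n] (mod q)" if "c \<in> fib" for c
  proof -
    have "line_root P c\<^sub>0 = line_root P c" using that by (simp add: fib_def)
    then obtain l where "c = (\<lambda>k. c\<^sub>0 k + l * P k)" by (rule line_root_eqD)
    then have "form_value d c n - form_value d c\<^sub>0 n = l * q" using shift by simp
    then show ?thesis by (simp add: cong_iff_dvd_diff)
  qed
  have "val ` fib = {t. lo \<le> t \<and> t \<le> hi \<and> [t = form_value d c\<^sub>0 n] (mod q)}"
  proof (intro equalityI subsetI)
    fix t assume "t \<in> val ` fib"
    then show "t \<in> {t. lo \<le> t \<and> t \<le> hi \<and> [t = form_value d c\<^sub>0 n] (mod q)}"
      using fin congr by (auto simp: lo_def hi_def val_def)
  next
    fix t assume "t \<in> {t. lo \<le> t \<and> t \<le> hi \<and> [t = form_value d c\<^sub>0 n] (mod q)}"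
    then have t: "lo \<le> t" "t \<le> hi" "[t = form_value d c\<^sub>0 n] (mod q)" by auto
    obtain a b where ab: "a \<in> fib" "b \<in> fib" "lo = val a" "hi = val b" using mem by auto
    then have "line_root P a = line_root P b" by (simp add: fib_def)
    then obtain m where m: "b = (\<lambda>k. a k + m * P k)" by (rule line_root_eqD)
    have "[t = lo] (mod q)" using t(3) congr[OF ab(1)] ab(3) val_def cong_sym cong_trans by metis
    then obtain l where l: "t = lo + l * q"
      by (metis cong_iff_dvd_diff dvdE add.commute diff_add_cancel mult.commute)
    have "hi = lo + m * q" using shift m ab by (simp add: val_def)
    then have "0 \<le> l * q" "0 \<le> (m - l) * q" using t l by (auto simp: algebra_simps)
    then have between: "0 \<le> l \<and> l \<le> m \<or> m \<le> l \<and> l \<le> 0"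
      using q by (auto simp: zero_le_mult_iff)
    define c where "c = (\<lambda>k. a k + l * P k)"
    have "\<bar>a k\<bar> \<le> h" "\<bar>a k + m * P k\<bar> \<le> h" for k
      using ab m by (auto simp: fib_def coeff_box_def)
    then have "\<bar>c k\<bar> \<le> h" for k
      unfolding c_def using abs_add_mult_le_between between by blast
    moreover have "c k = 0" if "k > d" for k
      using that ab assms(2) by (auto simp: c_def fib_def coeff_box_def)
    moreover have "line_root P c = line_root P c\<^sub>0"
      using ab by (simp add: c_def line_root_shift[OF P] fib_def)
    ultimately have "c \<in> fib" by (simp add: fib_def coeff_box_def)
    moreover have "val c = t" using l ab by (simp add: c_def shift val_def)
    ultimately show "t \<in> val ` fib" by blast
  qed
  then show "\<exists>lo hi. lo \<in> val ` fib \<and> hi \<in> val ` fib \<and>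
           val ` fib = {t. lo \<le> t \<and> t \<le> hi \<and> [t = form_value d c\<^sub>0 n] (mod q)}"
    using mem by blast
qed

text \<open>The form \<open>(v t\<^sub>1 - u t\<^sub>2) t\<^sub>1\<^bsup>d - 1\<^esup>\<close> or, if \<open>s = 0\<close>, the form
  \<open>(v t\<^sub>1 - u t\<^sub>2) t\<^sub>2\<^bsup>d - 1\<^esup>\<close>.\<close>

lemma exists_form_vanishing_at_one_point:
  fixes s t u v X :: int
  assumes "s * v - t * u \<noteq> 0" "d \<ge> 1" "\<bar>s\<bar> \<le> X" "\<bar>t\<bar> \<le> X" "\<bar>u\<bar> \<le> X" "\<bar>v\<bar> \<le> X"
  shows "\<exists>P. (\<forall>k>d. P k = 0) \<and> (\<forall>k. \<bar>P k\<bar> \<le> X) \<and> form_value d P (u, v) = 0 \<and>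
           form_value d P (s, t) \<noteq> 0 \<and> \<bar>form_value d P (s, t)\<bar> \<le> 2 * X ^ (d + 1)"
proof -
  define i where "i = (if s \<noteq> 0 then 0 else d - 1)"
  have i: "i < d" using assms(2) by (simp add: i_def)
  define P where "P = (\<lambda>k. (if k = i then v else 0) + (if k = Suc i then - u else 0))"
  have val: "form_value d P (a, b) = a ^ (d - 1 - i) * b ^ i * (a * v - b * u)" for a b
  proof -
    have "form_value d P (a, b) = v * (a ^ (d - i) * b ^ i) - u * (a ^ (d - Suc i) * b ^ Suc i)"
    proof -
      have "(if k = j then z else 0) * (a ^ (d - k) * b ^ k)
          = (if k = j then z * (a ^ (d - j) * b ^ j) else 0)" for k j :: nat and z :: int
        by simp
      then show ?thesis
        unfolding P_def form_value_add using i by (simp add: form_value_def sum.delta)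
    qed
    also have "\<dots> = v * (a ^ Suc (d - 1 - i) * b ^ i) - u * (a ^ (d - 1 - i) * b ^ Suc i)"
      using i Suc_diff_Suc[of i d] by simp
    also have "\<dots> = a ^ (d - 1 - i) * b ^ i * (a * v - b * u)"
      by (simp add: algebra_simps)
    finally show ?thesis .
  qed
  have "s ^ (d - 1 - i) * t ^ i \<noteq> 0"
    using assms(1) by (auto simp: i_def)
  then have "form_value d P (s, t) \<noteq> 0" using val assms(1) by simp
  moreover have "form_value d P (u, v) = 0" using val by simp
  moreover have "\<forall>k>d. P k = 0" using i by (simp add: P_def)
  moreover have "\<forall>k. \<bar>P k\<bar> \<le> X" using assms order_trans[OF abs_ge_zero assms(3)] by (simp add: P_def)
  moreover have "\<bar>form_value d P (s, t)\<bar> \<le> 2 * X ^ (d + 1)"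
  proof -
    have "\<bar>form_value d P (s, t)\<bar> \<le> X ^ (d - 1 - i) * X ^ i * (X * X + X * X)"
    proof -
      have "\<bar>s * v - t * u\<bar> \<le> \<bar>s\<bar> * \<bar>v\<bar> + \<bar>t\<bar> * \<bar>u\<bar>"
        by (metis abs_mult abs_triangle_ineq4)
      also have "\<dots> \<le> X * X + X * X" using assms by (intro add_mono mult_mono) auto
      finally show ?thesis
        unfolding val abs_mult power_abs using assms by (intro mult_mono power_mono) auto
    qed
    also have "\<dots> = 2 * X ^ (d + 1)"
    proof -
      have "X ^ (d - 1 - i) * X ^ i = X ^ (d - 1)" using i by (simp flip: power_add)
      moreover have "X ^ (d + 1) = X ^ (d - 1) * (X * X)"
        using assms(2) by (cases d) auto
      ultimately show ?thesis by (simp only: mult_2 distrib_left)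
    qed
    finally show ?thesis .
  qed
  ultimately show ?thesis by (intro exI[of _ P]) auto
qed

lemma form_values_along_lines:
  assumes "\<And>j. form_value (d j) (P j) n = 0"
  shows "form_values d (\<lambda>j k. c j k + l j * P j k) n = form_values d c n"
  using assms by (simp add: form_values_def form_value_add form_value_smult)

lemma form_values_line_roots:
  assumes "\<And>j. form_value (d j) (P j) n = 0"
  shows "form_values d (line_roots P c) n = form_values d c n"
proof -
  have "\<forall>j. \<exists>l. line_root (P j) (c j) = (\<lambda>k. c j k + l * P j k)"
    using line_root_shift_self by blast
  from choice[OF this] obtain l where "\<And>j. line_root (P j) (c j) = (\<lambda>k. c j k + l j * P j k)"
    by blast
  then have "line_roots P c = (\<lambda>j k. c j k + l j * P j k)" by (simp add: line_roots_def)
  then show ?thesis using form_values_along_lines[of d P n, OF assms] by simp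
qed

text \<open>The vectors of forms with prescribed roots are a product of lines, and their values at \<open>n\<close> form a
  product of intervals in residue classes.\<close>

lemma line_bundle_sum_le:
  fixes d :: "'m::finite \<Rightarrow> nat" and f :: "('m \<Rightarrow> int) \<Rightarrow> complex"
  assumes c\<^sub>0: "c\<^sub>0 \<in> coeff_boxes d h" and supp: "\<And>j k. k > d j \<Longrightarrow> P j k = 0"
    and q: "\<And>j. form_value (d j) (P j) n \<noteq> 0"
    and n: "\<bar>fst n\<bar> \<le> X" "\<bar>snd n\<bar> \<le> X"
    and x: "\<And>j. real_of_int ((int (d j) + 1) * (h * X ^ d j)) \<le> x j"
  shows "cmod (\<Sum>c | c \<in> coeff_boxes d h \<and> line_roots P c = line_roots P c\<^sub>0. f (form_values d c n))
    \<le> 2 ^ CARD('m) * equidist_error f x (\<lambda>j. form_value (d j) (P j) n)"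
proof -
  define fib where "fib j = {c \<in> coeff_box (d j) h. line_root (P j) c = line_root (P j) (c\<^sub>0 j)}" for j
  define val where "val j = (\<lambda>c. form_value (d j) c n)" for j
  have c\<^sub>0_j: "c\<^sub>0 j \<in> coeff_box (d j) h" for j using c\<^sub>0 by (simp add: coeff_boxes_def)
  have inj: "inj_on (val j) (fib j)" for j
    unfolding val_def fib_def using line_values_in_box(1)[OF c\<^sub>0_j supp q] .
  define ends where "ends j lo hi \<longleftrightarrow> lo \<in> val j ` fib j \<and> hi \<in> val j ` fib j \<and>
      val j ` fib j = {t. lo \<le> t \<and> t \<le> hi \<and> [t = val j (c\<^sub>0 j)] (mod val j (P j))}" for j lo hi
  have "\<exists>lo hi. ends j lo hi" for j
    unfolding ends_def val_def fib_def using line_values_in_box(2)[OF c\<^sub>0_j supp q] .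
  then obtain lo hi where ends: "\<And>j. ends j (lo j) (hi j)" by metis
  have mem: "lo j \<in> val j ` fib j" "hi j \<in> val j ` fib j"
    and image: "val j ` fib j = {t. lo j \<le> t \<and> t \<le> hi j \<and> [t = val j (c\<^sub>0 j)] (mod val j (P j))}" for j
    using ends[of j] unfolding ends_def by blast+
  have small: "\<bar>real_of_int t\<bar> \<le> x j" if t: "t \<in> val j ` fib j" for t j
  proof -
    obtain c where "c \<in> coeff_box (d j) h" "t = form_value (d j) c (fst n, snd n)"
      using t by (auto simp: fib_def val_def)
    then have "\<bar>t\<bar> \<le> (int (d j) + 1) * (h * X ^ d j)" using n abs_form_value_le by blast
    then show ?thesis using x[of j] by (metis of_int_abs of_int_le_iff order_trans)
  qed
  have set_eq: "{c. c \<in> coeff_boxes d h \<and> line_roots P c = line_roots P c\<^sub>0} = {c. \<forall>j. c j \<in> fib j}"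
    by (auto simp: coeff_boxes_def line_roots_def fib_def fun_eq_iff)
  have "inj_on (\<lambda>c. form_values d c n) {c. \<forall>j. c j \<in> fib j}"
  proof (rule inj_onI)
    fix b c assume *: "b \<in> {c. \<forall>j. c j \<in> fib j}" "c \<in> {c. \<forall>j. c j \<in> fib j}"
      "form_values d b n = form_values d c n"
    have "val j (b j) = val j (c j)" for j
      using fun_cong[OF *(3), of j] by (simp add: form_values_def val_def)
    then have "b j = c j" for j using inj[of j] * by (auto dest: inj_onD)
    then show "b = c" by auto
  qed
  moreover have "(\<lambda>c. form_values d c n) ` {c. \<forall>j. c j \<in> fib j} = {t. \<forall>j. t j \<in> val j ` fib j}"
  proof (intro equalityI subsetI)
    fix t assume "t \<in> {t. \<forall>j. t j \<in> val j ` fib j}"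
    then have "\<forall>j. \<exists>c. c \<in> fib j \<and> t j = val j c" by blast
    then obtain c where "\<And>j. c j \<in> fib j \<and> t j = val j (c j)" by metis
    then show "t \<in> (\<lambda>c. form_values d c n) ` {c. \<forall>j. c j \<in> fib j}"
      by (intro image_eqI[of _ _ c]) (auto simp: form_values_def val_def)
  qed (auto simp: form_values_def val_def)
  ultimately have "(\<Sum>c\<in>{c. \<forall>j. c j \<in> fib j}. f (form_values d c n))
      = (\<Sum>t | \<forall>j. lo j \<le> t j \<and> t j \<le> hi j \<and> [t j = val j (c\<^sub>0 j)] (mod val j (P j)). f t)"
    using sum.reindex[of "\<lambda>c. form_values d c n" "{c. \<forall>j. c j \<in> fib j}" f]
    by (simp add: image o_def)
  moreover have "cmod (\<Sum>t | \<forall>j. lo j \<le> t j \<and> t j \<le> hi j \<and> [t j = val j (c\<^sub>0 j)] (mod val j (P j)). f t)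
      \<le> 2 ^ CARD('m) * equidist_error f x (\<lambda>j. val j (P j))"
  proof (rule ap_box_sum_le_equidist_error)
    fix j
    show "- x j \<le> real_of_int (lo j)" "real_of_int (hi j) \<le> x j" "0 \<le> x j"
      using small[OF mem(1)[of j]] small[OF mem(2)[of j]] by linarith+
    show "val j (P j) \<noteq> 0" using q by (simp add: val_def)
  qed
  ultimately show ?thesis unfolding set_eq by (simp add: val_def)
qed

text \<open>A line may meet the box in very few points, but after prolongation into the box of twice the size it
  contains at least \<open>M + 1\<close> points, because \<open>M\<close> steps change each coefficient by at most \<open>h\<close>. So a
  function that is constant on the lines can be averaged along them.\<close>

lemma sum_over_line_roots_le:
  fixes d :: "'m::finite \<Rightarrow> nat" and W :: "('m \<Rightarrow> nat \<Rightarrow> int) \<Rightarrow> real"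
  assumes W: "\<And>c. W c \<ge> 0" "\<And>c. W (line_roots P c) = W c"
    and supp: "\<And>j k. k > d j \<Longrightarrow> P j k = 0" and P: "\<And>j. P j \<noteq> (\<lambda>_. 0)"
    and M: "\<And>j k. int M * \<bar>P j k\<bar> \<le> h"
  shows "(real M + 1) ^ CARD('m) * (\<Sum>G\<in>line_roots P ` coeff_boxes d h. W G)
    \<le> (\<Sum>c\<in>coeff_boxes d (2 * h). W c)"
proof -
  let ?R = "line_roots P ` coeff_boxes d h"
  let ?fib = "\<lambda>G. {c \<in> {c \<in> coeff_boxes d (2 * h). line_roots P c \<in> ?R}. line_roots P c = G}"
  have fin: "finite {c \<in> coeff_boxes d (2 * h). line_roots P c \<in> ?R}"
    using finite_coeff_boxes by (auto intro: finite_subset)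
  have card_fib: "(real M + 1) ^ CARD('m) \<le> real (card (?fib G))" if G: "G \<in> ?R" for G
  proof -
    obtain c where c: "c \<in> coeff_boxes d h" "G = line_roots P c" using G by blast
    let ?\<phi> = "\<lambda>l j k. c j k + l j * P j k"
    let ?L = "\<Pi>\<^sub>E j\<in>(UNIV :: 'm set). {0..int M}"
    have "inj_on ?\<phi> ?L"
    proof (rule inj_onI)
      fix l l' assume *: "?\<phi> l = ?\<phi> l'"
      have "l j = l' j" for j
      proof -
        obtain k where "P j k \<noteq> 0" using P[of j] by auto
        moreover have "c j k + l j * P j k = c j k + l' j * P j k" using * by (metis (no_types))
        ultimately show ?thesis by simp
      qed
      then show "l = l'" by auto
    qed
    moreover have "?\<phi> ` ?L \<subseteq> ?fib G"
    proof (rule image_subsetI)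
      fix l :: "'m \<Rightarrow> int" assume l: "l \<in> ?L"
      have "\<bar>c j k + l j * P j k\<bar> \<le> 2 * h" for j k
      proof -
        have "\<bar>c j k\<bar> \<le> h" using c by (simp add: coeff_boxes_def coeff_box_def)
        moreover have "0 \<le> l j" "l j \<le> int M" using l by (auto simp: PiE_def)
        then have "\<bar>l j * P j k\<bar> \<le> int M * \<bar>P j k\<bar>" by (simp add: abs_mult mult_right_mono)
        ultimately show ?thesis using M[of j k] by linarith
      qed
      then have "?\<phi> l \<in> coeff_boxes d (2 * h)"
        using c supp by (auto simp: coeff_boxes_def coeff_box_def)
      moreover have "line_roots P (?\<phi> l) = G"
        by (simp add: line_roots_def c line_root_shift[OF P])
      ultimately show "?\<phi> l \<in> ?fib G" using G by simp
    qed
    ultimately have "card ?L \<le> card (?fib G)"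
      using finite_subset[OF _ fin, of "?fib G"] by (intro card_inj_on_le) auto
    moreover have "real (card ?L) = (real M + 1) ^ CARD('m)" by (simp add: card_PiE add.commute)
    ultimately show ?thesis by linarith
  qed
  have "(real M + 1) ^ CARD('m) * (\<Sum>G\<in>?R. W G) = (\<Sum>G\<in>?R. (real M + 1) ^ CARD('m) * W G)"
    by (rule sum_distrib_left)
  also have "\<dots> \<le> (\<Sum>G\<in>?R. \<Sum>c\<in>?fib G. W c)"
  proof (rule sum_mono)
    fix G assume G: "G \<in> ?R"
    have "W c = W G" if "c \<in> ?fib G" for c using that W(2)[of c] by simp
    then have "(\<Sum>c\<in>?fib G. W c) = (\<Sum>c\<in>?fib G. W G)" by (rule sum.cong[OF refl])
    then have "(\<Sum>c\<in>?fib G. W c) = real (card (?fib G)) * W G" by simp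
    then show "(real M + 1) ^ CARD('m) * W G \<le> (\<Sum>c\<in>?fib G. W c)"
      using card_fib[OF G] W(1) by (simp add: mult_right_mono)
  qed
  also have "\<dots> = (\<Sum>c\<in>{c \<in> coeff_boxes d (2 * h). line_roots P c \<in> ?R}. W c)"
    using finite_coeff_boxes fin by (intro sum.group) auto
  also have "\<dots> \<le> (\<Sum>c\<in>coeff_boxes d (2 * h). W c)"
    using finite_coeff_boxes W by (intro sum_mono2) auto
  finally show ?thesis .
qed

text \<open>On each bundle of lines the factor belonging to \<open>n\<^sub>2\<close> is constant, and the factor belonging to
  \<open>n\<^sub>1\<close> sums to at most \<open>2\<^sup>m\<close> times the equidistribution error. The number of steps available for the averaging
  is \<open>M = h div X\<close>.\<close>

lemma independent_pair_sum_le: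
  fixes d :: "'m::finite \<Rightarrow> nat" and f :: "('m \<Rightarrow> int) \<Rightarrow> complex"
  assumes det: "fst n\<^sub>1 * snd n\<^sub>2 - snd n\<^sub>1 * fst n\<^sub>2 \<noteq> 0" and d: "\<And>j. d j \<ge> 1"
    and n: "\<bar>fst n\<^sub>1\<bar> \<le> X" "\<bar>snd n\<^sub>1\<bar> \<le> X" "\<bar>fst n\<^sub>2\<bar> \<le> X" "\<bar>snd n\<^sub>2\<bar> \<le> X"
    and X: "1 \<le> X" "X \<le> h"
    and x: "\<And>j. real_of_int ((int (d j) + 1) * (h * X ^ d j)) \<le> x j"
  shows "\<exists>q. (\<forall>j. q j \<noteq> 0 \<and> \<bar>q j\<bar> \<le> 2 * X ^ (d j + 1)) \<and>
    cmod (\<Sum>c\<in>coeff_boxes d h. f (form_values d c n\<^sub>1) * cnj (f (form_values d c n\<^sub>2)))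
      \<le> 2 ^ CARD('m) * equidist_error f x q * (real_of_int X / real_of_int h) ^ CARD('m) *
          (\<Sum>c\<in>coeff_boxes d (2 * h). cmod (f (form_values d c n\<^sub>2)))"
proof -
  have "\<exists>P. (\<forall>k>d j. P k = 0) \<and> (\<forall>k. \<bar>P k\<bar> \<le> X) \<and> form_value (d j) P n\<^sub>2 = 0 \<and>
      form_value (d j) P n\<^sub>1 \<noteq> 0 \<and> \<bar>form_value (d j) P n\<^sub>1\<bar> \<le> 2 * X ^ (d j + 1)" for j
    using exists_form_vanishing_at_one_point[OF det d n(1,2,3,4), of j] by simp
  then obtain P where supp: "\<And>j k. k > d j \<Longrightarrow> P j k = 0" and P_le: "\<And>j k. \<bar>P j k\<bar> \<le> X"
    and P2: "\<And>j. form_value (d j) (P j) n\<^sub>2 = 0" and P1: "\<And>j. form_value (d j) (P j) n\<^sub>1 \<noteq> 0"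
    and P1_le: "\<And>j. \<bar>form_value (d j) (P j) n\<^sub>1\<bar> \<le> 2 * X ^ (d j + 1)"
    by metis
  define q where "q = (\<lambda>j. form_value (d j) (P j) n\<^sub>1)"
  define W where "W c = cmod (f (form_values d c n\<^sub>2))" for c
  let ?B = "coeff_boxes d h" and ?E = "2 ^ CARD('m) * equidist_error f x q"
  have W_root: "W (line_roots P c) = W c" for c
    by (simp add: W_def form_values_line_roots[OF P2])
  have P_nz: "P j \<noteq> (\<lambda>_. 0)" for j
    using P1[of j] by (auto simp: form_value_def)
  have E_nonneg: "0 \<le> ?E"
  proof -
    have "(\<lambda>_ _. 0) \<in> ?B" using X by (simp add: coeff_boxes_def coeff_box_def)
    from line_bundle_sum_le[of _ d h P n\<^sub>1 X x f, OF this supp P1 n(1,2) x]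
    show ?thesis unfolding q_def by (meson norm_ge_zero order_trans)
  qed
  define M where "M = nat (h div X)"
  have M: "int M = h div X" using X by (simp add: M_def pos_imp_zdiv_nonneg_iff)
  have div_part: "int M * X + h mod X = h" "0 \<le> h mod X" "h mod X < X"
    using X by (auto simp: M)
  have "int M * \<bar>P j k\<bar> \<le> h" for j k
  proof -
    have "int M * \<bar>P j k\<bar> \<le> int M * X" using P_le by (intro mult_left_mono) auto
    also have "\<dots> \<le> h" using div_part by linarith
    finally show ?thesis .
  qed
  then have roots: "(real M + 1) ^ CARD('m) * (\<Sum>G\<in>line_roots P ` ?B. W G)
      \<le> (\<Sum>c\<in>coeff_boxes d (2 * h). W c)"
    using sum_over_line_roots_le[of W P d M h] W_root supp P_nz by (simp add: W_def)
  have "h < (int M + 1) * X"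
    using div_part by (simp add: distrib_right)
  then have "real_of_int h \<le> real_of_int ((int M + 1) * X)" by linarith
  then have "real_of_int h \<le> (real M + 1) * real_of_int X" by simp
  then have ratio: "1 \<le> real_of_int X / real_of_int h * (real M + 1)"
    using X by (simp add: field_simps)
  have nonneg: "0 \<le> (\<Sum>G\<in>line_roots P ` ?B. W G)" by (simp add: W_def sum_nonneg)
  have "(\<Sum>G\<in>line_roots P ` ?B. W G)
      \<le> (real_of_int X / real_of_int h * (real M + 1)) ^ CARD('m) * (\<Sum>G\<in>line_roots P ` ?B. W G)"
    using ratio nonneg mult_right_mono[OF one_le_power[OF ratio]] by fastforce
  also have "\<dots> = (real_of_int X / real_of_int h) ^ CARD('m) *
      ((real M + 1) ^ CARD('m) * (\<Sum>G\<in>line_roots P ` ?B. W G))"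
    by (simp only: power_mult_distrib mult.assoc)
  also have "\<dots> \<le> (real_of_int X / real_of_int h) ^ CARD('m) * (\<Sum>c\<in>coeff_boxes d (2 * h). W c)"
    using roots X by (intro mult_left_mono) auto
  finally have sum_roots: "(\<Sum>G\<in>line_roots P ` ?B. W G)
      \<le> (real_of_int X / real_of_int h) ^ CARD('m) * (\<Sum>c\<in>coeff_boxes d (2 * h). W c)" .
  have bundle_sum: "cmod (\<Sum>c\<in>{c \<in> ?B. line_roots P c = G}.
        f (form_values d c n\<^sub>1) * cnj (f (form_values d c n\<^sub>2))) \<le> ?E * W G"
    if G: "G \<in> line_roots P ` ?B" for G
  proof -
    obtain c\<^sub>0 where c\<^sub>0: "c\<^sub>0 \<in> ?B" "G = line_roots P c\<^sub>0" using G by blast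
    have "form_values d c n\<^sub>2 = form_values d G n\<^sub>2" if "line_roots P c = G" for c
      using that form_values_line_roots[of d P n\<^sub>2 c, OF P2] by simp
    then have "(\<Sum>c\<in>{c \<in> ?B. line_roots P c = G}. f (form_values d c n\<^sub>1) * cnj (f (form_values d c n\<^sub>2)))
        = (\<Sum>c\<in>{c \<in> ?B. line_roots P c = G}. f (form_values d c n\<^sub>1)) * cnj (f (form_values d G n\<^sub>2))"
      by (simp add: sum_distrib_right)
    then show ?thesis
      using line_bundle_sum_le[of c\<^sub>0 d h P n\<^sub>1 X x f, OF c\<^sub>0(1) supp P1 n(1,2) x] c\<^sub>0(2)
      by (simp add: norm_mult W_def q_def mult_right_mono)
  qed
  have "(\<Sum>c\<in>?B. f (form_values d c n\<^sub>1) * cnj (f (form_values d c n\<^sub>2)))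
      = (\<Sum>G\<in>line_roots P ` ?B. \<Sum>c\<in>{c \<in> ?B. line_roots P c = G}.
          f (form_values d c n\<^sub>1) * cnj (f (form_values d c n\<^sub>2)))"
    by (rule sum.image_gen) (rule finite_coeff_boxes)
  then have "cmod (\<Sum>c\<in>?B. f (form_values d c n\<^sub>1) * cnj (f (form_values d c n\<^sub>2)))
      \<le> (\<Sum>G\<in>line_roots P ` ?B. ?E * W G)"
    using bundle_sum by (simp add: sum_norm_le)
  also have "\<dots> = ?E * (\<Sum>G\<in>line_roots P ` ?B. W G)" by (rule sum_distrib_left[symmetric])
  also have "\<dots> \<le> ?E * ((real_of_int X / real_of_int h) ^ CARD('m) * (\<Sum>c\<in>coeff_boxes d (2 * h). W c))"
    using sum_roots E_nonneg by (rule mult_left_mono)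
  finally show ?thesis
    using P1 P1_le by (intro exI[of _ q]) (simp add: q_def W_def mult.assoc)
qed

section \<open>From correlations to the mean square\<close>

lemma sum_norm_square_le_pair_sums:
  fixes V :: "'a \<Rightarrow> 'b \<Rightarrow> complex"
  assumes "\<And>n. cmod (a n) \<le> 1"
  shows "(\<Sum>c\<in>S. (cmod (\<Sum>n\<in>T. a n * V c n))\<^sup>2)
    \<le> (\<Sum>n\<in>T. \<Sum>n'\<in>T. cmod (\<Sum>c\<in>S. V c n * cnj (V c n')))"
proof -
  have "complex_of_real (\<Sum>c\<in>S. (cmod (\<Sum>n\<in>T. a n * V c n))\<^sup>2)
      = (\<Sum>c\<in>S. (\<Sum>n\<in>T. a n * V c n) * cnj (\<Sum>n\<in>T. a n * V c n))"
    by (simp only: of_real_sum complex_norm_square)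
  also have "\<dots> = (\<Sum>c\<in>S. \<Sum>n\<in>T. \<Sum>n'\<in>T. a n * cnj (a n') * (V c n * cnj (V c n')))"
    by (simp add: cnj_sum sum_product mult_ac)
  also have "\<dots> = (\<Sum>n\<in>T. \<Sum>n'\<in>T. a n * cnj (a n') * (\<Sum>c\<in>S. V c n * cnj (V c n')))"
    unfolding sum_distrib_left by (subst sum.swap, intro sum.cong refl, rule sum.swap)
  finally have expand: "complex_of_real (\<Sum>c\<in>S. (cmod (\<Sum>n\<in>T. a n * V c n))\<^sup>2)
      = (\<Sum>n\<in>T. \<Sum>n'\<in>T. a n * cnj (a n') * (\<Sum>c\<in>S. V c n * cnj (V c n')))" .
  have "(\<Sum>c\<in>S. (cmod (\<Sum>n\<in>T. a n * V c n))\<^sup>2)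
      = cmod (complex_of_real (\<Sum>c\<in>S. (cmod (\<Sum>n\<in>T. a n * V c n))\<^sup>2))"
    by (simp only: norm_of_real abs_of_nonneg sum_nonneg zero_le_power2)
  also have "\<dots> \<le> (\<Sum>n\<in>T. \<Sum>n'\<in>T. cmod (\<Sum>c\<in>S. V c n * cnj (V c n')))"
    unfolding expand
  proof (intro order_trans[OF norm_sum] sum_mono)
    fix n n'
    have "cmod (a n) * cmod (a n') \<le> 1 * 1" using assms by (intro mult_mono) auto
    then show "cmod (a n * cnj (a n') * (\<Sum>c\<in>S. V c n * cnj (V c n')))
        \<le> cmod (\<Sum>c\<in>S. V c n * cnj (V c n'))"
      by (simp add: norm_mult mult_left_le_one_le)
  qed
  finally show ?thesis .
qed

lemma pair_sum_le_second_moment: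
  fixes u v :: "'a \<Rightarrow> complex"
  assumes "(\<Sum>c\<in>S. (cmod (u c))\<^sup>2) \<le> M" "(\<Sum>c\<in>S. (cmod (v c))\<^sup>2) \<le> M"
  shows "cmod (\<Sum>c\<in>S. u c * cnj (v c)) \<le> M"
proof -
  have "cmod (\<Sum>c\<in>S. u c * cnj (v c)) \<le> (\<Sum>c\<in>S. ((cmod (u c))\<^sup>2 + (cmod (v c))\<^sup>2) / 2)"
  proof (rule sum_norm_le)
    fix c
    have "0 \<le> (cmod (u c) - cmod (v c))\<^sup>2" by simp
    then show "cmod (u c * cnj (v c)) \<le> ((cmod (u c))\<^sup>2 + (cmod (v c))\<^sup>2) / 2"
      by (simp add: norm_mult power2_diff)
  qed
  also have "\<dots> = ((\<Sum>c\<in>S. (cmod (u c))\<^sup>2) + (\<Sum>c\<in>S. (cmod (v c))\<^sup>2)) / 2"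
    by (simp add: sum.distrib flip: sum_divide_distrib)
  also have "\<dots> \<le> M" using assms by simp
  finally show ?thesis .
qed

text \<open>A point \<open>n \<noteq> 0\<close> has at most one multiple with a given coordinate, if that coordinate of \<open>n\<close> is
  nonzero, and the point \<open>0\<close> is dependent on all others.\<close>

lemma card_dependent_points_le:
  fixes X :: int
  assumes "X \<ge> 1"
  defines "T \<equiv> {-X..X} \<times> {-X..X}"
  shows "real (card {(n, n'). n \<in> T \<and> n' \<in> T \<and> fst n * snd n' - snd n * fst n' = 0})
    \<le> 2 * (2 * real_of_int X + 1) ^ 3"
proof -
  let ?K = "2 * real_of_int X + 1"
  have K: "real (card {-X..X}) = ?K" "?K \<ge> 1" using assms by auto
  let ?D = "\<lambda>n. {n' \<in> T. fst n * snd n' - snd n * fst n' = 0}"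
  have fin: "finite T" by (simp add: T_def)
  have card_D: "real (card (?D n)) \<le> ?K + (if n = (0, 0) then ?K ^ 2 else 0)" for n
  proof (cases "n = (0, 0)")
    case True
    have "card (?D n) \<le> card T" using fin by (intro card_mono) auto
    also have "card T = card {-X..X} ^ 2" by (simp add: T_def card_cartesian_product power2_eq_square)
    finally have "real (card (?D n)) \<le> real (card {-X..X} ^ 2)" by (rule of_nat_mono)
    then have "real (card (?D n)) \<le> ?K ^ 2" unfolding of_nat_power K(1) .
    then show ?thesis using True K by simp
  next
    case False
    have "card (?D n) \<le> card {-X..X}"
    proof (cases "fst n = 0")
      case True
      with False have "snd n \<noteq> 0" by (cases n) auto
      then have "inj_on snd (?D n)" using True by (auto intro!: inj_onI prod_eqI)
      then show ?thesis by (rule card_inj_on_le) (auto simp: T_def)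
    next
      case False
      have "inj_on fst (?D n)"
      proof (rule inj_onI)
        fix p q assume *: "p \<in> ?D n" "q \<in> ?D n" "fst p = fst q"
        then have "fst n * snd p = fst n * snd q" by simp
        then show "p = q" using False * by (simp add: prod_eq_iff)
      qed
      then show ?thesis by (rule card_inj_on_le) (auto simp: T_def)
    qed
    then show ?thesis using False K by simp
  qed
  have "{(n, n'). n \<in> T \<and> n' \<in> T \<and> fst n * snd n' - snd n * fst n' = 0} = (SIGMA n:T. ?D n)" by auto
  then have "real (card {(n, n'). n \<in> T \<and> n' \<in> T \<and> fst n * snd n' - snd n * fst n' = 0})
      = (\<Sum>n\<in>T. real (card (?D n)))"
    using fin by (simp add: card_SigmaI)
  also have "\<dots> \<le> (\<Sum>n\<in>T. ?K + (if n = (0, 0) then ?K ^ 2 else 0))" by (intro sum_mono card_D)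
  also have "\<dots> = real (card T) * ?K + ?K ^ 2"
    using fin assms by (simp add: sum.distrib T_def)
  also have "real (card T) = ?K ^ 2" using K by (simp add: T_def card_cartesian_product power2_eq_square)
  also have "?K ^ 2 * ?K + ?K ^ 2 \<le> 2 * ?K ^ 3"
    using K power_increasing[of 2 3 ?K] by (simp add: power3_eq_cube power2_eq_square)
  finally show ?thesis .
qed

text \<open>The combinatorial core: the second moments and the equidistribution errors enter only through the
  bounds \<open>M\<close> and \<open>e\<close>. The second box \<open>2 \<lfloor>H\<rfloor>\<close> is the one needed for averaging along lines.\<close>

lemma mean_square_le:
  fixes d :: "'m::finite \<Rightarrow> nat" and f :: "('m \<Rightarrow> int) \<Rightarrow> complex" and H x M e :: real
  assumes d: "\<And>j. d j \<ge> 1" and a: "\<And>n. cmod (a n) \<le> 1" and x: "1 \<le> x" "x \<le> H"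
    and M: "M \<ge> 0" and e: "e \<ge> 0"
    and moment: "\<And>h n. h \<in> {\<lfloor>H\<rfloor>, 2 * \<lfloor>H\<rfloor>} \<Longrightarrow>
      \<bar>real_of_int (fst n)\<bar> \<le> x \<Longrightarrow> \<bar>real_of_int (snd n)\<bar> \<le> x \<Longrightarrow>
      (\<Sum>c\<in>coeff_boxes d h. (cmod (f (form_values d c n)))\<^sup>2) \<le> M * real (card (coeff_boxes d h))"
    and err: "\<And>q. (\<And>j. q j \<noteq> 0 \<and> real_of_int \<bar>q j\<bar> \<le> 2 * x ^ (2 * d j)) \<Longrightarrow>
      equidist_error f (\<lambda>j. (1 + real (d j)) * x ^ d j * H) q \<le> e * H ^ CARD('m)"
  shows "1 / real (card (forms_Z d H)) *
      (\<Sum>F\<in>forms_Z d H.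
        (cmod (1 / complex_of_real (x ^ 2) *
          (\<Sum>n\<in>{n. \<bar>real_of_int (fst n)\<bar> \<le> x \<and> \<bar>real_of_int (snd n)\<bar> \<le> x}.
            a n * f (\<lambda>j. bieval (F j) n)))) ^ 2)
    \<le> 54 * M / x + 81 * 4 ^ CARD('m) * 2 ^ (\<Sum>j\<in>UNIV. d j + 1) * (1 + M) * x ^ CARD('m) * e"
proof -
  define X h where "X = \<lfloor>x\<rfloor>" and "h = \<lfloor>H\<rfloor>"
  have Xh: "1 \<le> X" "X \<le> h" "real_of_int X \<le> x" "real_of_int h \<le> H" "H \<le> 2 * real_of_int h"
  proof -
    show "1 \<le> X" using x by (simp add: X_def)
    show "X \<le> h" using x by (simp add: X_def h_def floor_mono)
    show "real_of_int X \<le> x" "real_of_int h \<le> H" by (simp_all add: X_def h_def)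
    have "1 \<le> h" using x by (simp add: h_def)
    moreover have "H < real_of_int h + 1" unfolding h_def by linarith
    ultimately show "H \<le> 2 * real_of_int h" by linarith
  qed
  let ?m = "CARD('m)"
  define S where "S = coeff_boxes d h"
  define T where "T = {-X..X} \<times> {-X..X}"
  define K where "K = 2 * real_of_int X + 1"
  define pair where "pair n n' = cmod (\<Sum>c\<in>S. f (form_values d c n) * cnj (f (form_values d c n')))" for n n'
  define D where "D = {(n, n'). n \<in> T \<and> n' \<in> T \<and> fst n * snd n' - snd n * fst n' = 0}"
  define R where "R = 4 ^ ?m * 2 ^ (\<Sum>j\<in>UNIV. d j + 1) * (1 + M) * x ^ ?m * e * real (card S)"
  have T_iff: "n \<in> T \<longleftrightarrow> \<bar>real_of_int (fst n)\<bar> \<le> x \<and> \<bar>real_of_int (snd n)\<bar> \<le> x" for n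
  proof -
    have "\<bar>real_of_int k\<bar> \<le> x \<longleftrightarrow> k \<in> {-X..X}" for k
      unfolding X_def of_int_abs[symmetric] le_floor_iff[symmetric] by auto
    then show ?thesis by (cases n) (simp add: T_def)
  qed
  have fin: "finite T" "finite S" by (simp_all add: T_def S_def finite_coeff_boxes)
  have K: "0 \<le> K" "K \<le> 3 * x" using Xh x by (auto simp: K_def)
  have card_T: "real (card T) = K ^ 2"
    using Xh by (simp add: T_def card_cartesian_product power2_eq_square K_def)
  have card_S: "real (card S) > 0"
    using Xh by (simp add: S_def card_coeff_boxes card_coeff_box prod_pos)
  have R: "R \<ge> 0" using M e x by (simp add: R_def)

  have dependent: "pair n n' \<le> M * real (card S)" if "n \<in> T" "n' \<in> T" for n n'
    unfolding pair_def S_def using that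
    by (intro pair_sum_le_second_moment moment) (auto simp: T_iff h_def)

  have independent: "pair n n' \<le> R"
    if n: "n \<in> T" "n' \<in> T" and det: "fst n * snd n' - snd n * fst n' \<noteq> 0" for n n'
  proof -
    let ?x = "\<lambda>j. (1 + real (d j)) * x ^ d j * H"
    have range: "real_of_int ((int (d j) + 1) * (h * X ^ d j)) \<le> ?x j" for j
    proof -
      have "real_of_int X ^ d j \<le> x ^ d j" using Xh by (intro power_mono) auto
      then have "(real (d j) + 1) * (real_of_int h * real_of_int X ^ d j) \<le> (real (d j) + 1) * (H * x ^ d j)"
        using Xh x by (intro mult_left_mono mult_mono) auto
      then show ?thesis by (simp add: mult_ac add.commute)
    qed
    have n_le: "\<bar>fst n\<bar> \<le> X" "\<bar>snd n\<bar> \<le> X" "\<bar>fst n'\<bar> \<le> X" "\<bar>snd n'\<bar> \<le> X"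
      using n by (auto simp: T_def)
    obtain q where q: "\<And>j. q j \<noteq> 0 \<and> \<bar>q j\<bar> \<le> 2 * X ^ (d j + 1)"
      and pair: "pair n n' \<le> 2 ^ ?m * equidist_error f ?x q * (real_of_int X / real_of_int h) ^ ?m *
          (\<Sum>c\<in>coeff_boxes d (2 * h). cmod (f (form_values d c n')))"
      using independent_pair_sum_le[where f = f and x = ?x, OF det d n_le Xh(1,2) range]
      unfolding pair_def S_def by blast
    have q_le: "real_of_int \<bar>q j\<bar> \<le> 2 * x ^ (2 * d j)" for j
    proof -
      have "real_of_int \<bar>q j\<bar> \<le> real_of_int (2 * X ^ (d j + 1))" using q by (simp only: of_int_le_iff)
      also have "\<dots> = 2 * real_of_int X ^ (d j + 1)" by simp
      also have "\<dots> \<le> 2 * x ^ (d j + 1)" using Xh by (intro mult_left_mono power_mono) auto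
      also have "\<dots> \<le> 2 * x ^ (2 * d j)"
        using x d[of j] by (intro mult_left_mono power_increasing) auto
      finally show ?thesis .
    qed
    have E: "equidist_error f ?x q \<le> e * H ^ ?m" using q q_le by (intro err) auto
    have E_nonneg: "0 \<le> equidist_error f ?x q"
      using q x by (intro equidist_error_nonneg) auto
    have "(\<Sum>c\<in>coeff_boxes d (2 * h). cmod (f (form_values d c n')))
        \<le> (\<Sum>c\<in>coeff_boxes d (2 * h). 1 + (cmod (f (form_values d c n')))\<^sup>2)"
    proof (rule sum_mono)
      fix c
      have "0 \<le> (cmod (f (form_values d c n')) - 1)\<^sup>2" by simp
      then show "cmod (f (form_values d c n')) \<le> 1 + (cmod (f (form_values d c n')))\<^sup>2"
        by (simp add: power2_diff) (use norm_ge_zero[of "f (form_values d c n')"] in linarith)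
    qed
    also have "\<dots> \<le> (1 + M) * real (card (coeff_boxes d (2 * h)))"
      using moment[of "2 * h" n'] n by (simp add: sum.distrib h_def T_iff algebra_simps)
    also have "\<dots> \<le> (1 + M) * (2 ^ (\<Sum>j\<in>UNIV. d j + 1) * real (card S))"
      unfolding S_def using Xh M by (intro mult_left_mono card_coeff_boxes_double_le) auto
    finally have moment1: "(\<Sum>c\<in>coeff_boxes d (2 * h). cmod (f (form_values d c n')))
        \<le> (1 + M) * (2 ^ (\<Sum>j\<in>UNIV. d j + 1) * real (card S))" .
    have "real_of_int X / real_of_int h \<le> 2 * x / H"
    proof -
      have "real_of_int X * H \<le> x * (2 * real_of_int h)" using Xh x by (intro mult_mono) auto
      then show ?thesis using Xh x by (simp add: field_simps)
    qed
    then have "(real_of_int X / real_of_int h) ^ ?m \<le> (2 * x / H) ^ ?m"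
      using Xh by (intro power_mono) auto
    then have "pair n n' \<le> 2 ^ ?m * (e * H ^ ?m) * (2 * x / H) ^ ?m *
        ((1 + M) * (2 ^ (\<Sum>j\<in>UNIV. d j + 1) * real (card S)))"
      using E E_nonneg moment1 e x Xh
      by (intro order_trans[OF pair] mult_mono mult_nonneg_nonneg sum_nonneg) auto
    also have "\<dots> = (2 * 2) ^ ?m * 2 ^ (\<Sum>j\<in>UNIV. d j + 1) * (1 + M) * x ^ ?m * e * real (card S)"
      using x unfolding power_mult_distrib power_divide by (simp add: field_simps)
    finally show ?thesis by (simp add: R_def)
  qed

  have pairs: "(\<Sum>n\<in>T. \<Sum>n'\<in>T. pair n n') \<le> real (card D) * (M * real (card S)) + K ^ 4 * R"
  proof -
    have "(\<Sum>n\<in>T. \<Sum>n'\<in>T. pair n n') = (\<Sum>(n, n')\<in>T \<times> T. pair n n')"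
      by (rule sum.cartesian_product)
    also have "\<dots> \<le> (\<Sum>p\<in>T \<times> T. (if p \<in> D then M * real (card S) else 0) + R)"
    proof (intro sum_mono, clarify)
      fix n n' assume "n \<in> T" "n' \<in> T"
      then show "pair n n' \<le> (if (n, n') \<in> D then M * real (card S) else 0) + R"
        using dependent[of n n'] independent[of n n'] R by (auto simp: D_def)
    qed
    also have "\<dots> = real (card D) * (M * real (card S)) + real (card (T \<times> T)) * R"
    proof -
      have "D \<subseteq> T \<times> T" by (auto simp: D_def)
      then have "T \<times> T \<inter> {p. p \<in> D} = D" by blast
      then show ?thesis
        using fin by (simp add: sum.distrib sum.If_cases del: Collect_mem_eq)
    qed
    also have "real (card (T \<times> T)) = K ^ 4"
      by (simp add: card_cartesian_product card_T flip: power_add)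
    finally show ?thesis .
  qed
  have card_D: "real (card D) \<le> 2 * K ^ 3"
    unfolding D_def T_def K_def using Xh by (intro card_dependent_points_le)

  let ?V = "\<lambda>c. \<Sum>n\<in>T. a n * f (form_values d c n)"
  have card_forms: "card (forms_Z d H) = card S"
    unfolding S_def h_def using x bij_betw_same_card[OF bij_betw_coeff_boxes_forms_Z[of H d]] by simp
  have T_eq: "{n. \<bar>real_of_int (fst n)\<bar> \<le> x \<and> \<bar>real_of_int (snd n)\<bar> \<le> x} = T"
    using T_iff by blast
  \<comment> \<open>The constants come from \<open>2 X + 1 \<le> 3 x\<close>: \<open>54 = 2 \<cdot> 3\<^sup>3\<close> and \<open>81 = 3\<^sup>4\<close>.\<close>
  have "(\<Sum>F\<in>forms_Z d H. (cmod (1 / complex_of_real (x ^ 2) *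
          (\<Sum>n\<in>T. a n * f (\<lambda>j. bieval (F j) n)))) ^ 2)
      = (\<Sum>c\<in>S. (cmod (1 / complex_of_real (x ^ 2) * ?V c)) ^ 2)"
    unfolding S_def h_def
    using x by (intro sum_forms_Z[where
        g = "\<lambda>v. (cmod (1 / complex_of_real (x ^ 2) * (\<Sum>n\<in>T. a n * f (v n)))) ^ 2"]) simp
  also have "\<dots> = (\<Sum>c\<in>S. (cmod (?V c))\<^sup>2) / x ^ 4"
  proof -
    have "(cmod (1 / complex_of_real (x ^ 2) * z)) ^ 2 = (cmod z)\<^sup>2 / x ^ 4" for z
      using x by (simp add: norm_mult norm_divide norm_power power_mult_distrib power_divide)
    then show ?thesis by (simp only: sum_divide_distrib)
  qed
  also have "\<dots> \<le> (\<Sum>n\<in>T. \<Sum>n'\<in>T. pair n n') / x ^ 4"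
    unfolding pair_def using a by (intro divide_right_mono sum_norm_square_le_pair_sums) auto
  also have "\<dots> \<le> (2 * (3 * x) ^ 3 * (M * real (card S)) + (3 * x) ^ 4 * R) / x ^ 4"
  proof (rule divide_right_mono)
    have "real (card D) * (M * real (card S)) \<le> 2 * (3 * x) ^ 3 * (M * real (card S))"
      using card_D power_mono[OF K(2,1), of 3] M by (intro mult_right_mono) auto
    moreover have "K ^ 4 * R \<le> (3 * x) ^ 4 * R"
      using K R by (intro mult_right_mono power_mono)
    ultimately show "(\<Sum>n\<in>T. \<Sum>n'\<in>T. pair n n')
        \<le> 2 * (3 * x) ^ 3 * (M * real (card S)) + (3 * x) ^ 4 * R"
      using pairs by linarith
  qed (use x in auto)
  also have "\<dots> = real (card S) * (54 * M / x +
      81 * 4 ^ ?m * 2 ^ (\<Sum>j\<in>UNIV. d j + 1) * (1 + M) * x ^ ?m * e)"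
    using x unfolding R_def power_mult_distrib
    by (simp add: field_simps power4_eq_xxxx power3_eq_cube)
  finally show ?thesis
    unfolding T_eq card_forms using card_S by (simp add: field_simps)
qed

section \<open>Comparison of the exponents\<close>

lemma one_less_ln_3: "1 < ln (3::real)"
proof -
  (* (6 / 5) ^ 6 = 2.985984 < 3 *)
  have "ln (5 / 6 :: real) \<le> 5 / 6 - 1" by (intro ln_le_minus_one) simp
  then have "1 \<le> - 6 * ln (5 / 6 :: real)" by simp
  also have "\<dots> = ln ((6 / 5 :: real) ^ 6)"
    using ln_inverse[of "5 / 6 :: real"] by (simp add: ln_realpow)
  also have "\<dots> < ln 3" by (subst ln_less_cancel_iff) (auto simp: power_divide)
  finally show ?thesis .
qed

text \<open>The least integer exponent \<open>b\<close> with which \<open>tau_weight_le_sum_divisors\<close> applies to the weight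
  \<open>\<tau>\<^bsup>2 C\<^esup>\<close> at values below \<open>Y\<^bsup>d + 1\<^esup>\<close>. Rounding up to an integer at most doubles the
  exponent \<open>2\<^sup>b\<close> of the logarithm.\<close>

definition moment_exponent :: "real \<Rightarrow> nat \<Rightarrow> nat" where
  "moment_exponent C d = nat \<lceil>4 * C * (real d + 1)\<rceil>"

lemma moment_exponent_ge: "4 * C * (real d + 1) \<le> real (moment_exponent C d)"
  unfolding moment_exponent_def by linarith

lemma two_power_moment_exponent_le:
  assumes "C \<ge> 0"
  shows "2 ^ moment_exponent C d \<le> 2 * 2 powr (4 * C * (real d + 1))"
proof -
  have "0 \<le> 4 * C * (real d + 1)" using assms by simp
  then have "real (moment_exponent C d) \<le> 1 + 4 * C * (real d + 1)"
    unfolding moment_exponent_def by linarith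
  then have "2 powr real (moment_exponent C d) \<le> 2 powr (1 + 4 * C * (real d + 1))"
    by (intro powr_mono) auto
  then show ?thesis by (simp add: powr_realpow powr_add)
qed

lemma max_degree_ge_1:
  fixes d :: "'m::finite \<Rightarrow> nat"
  assumes "\<And>j. d j \<ge> 1"
  shows "max_degree d \<ge> 1"
proof -
  have "d undefined \<le> max_degree d" unfolding max_degree_def by (rule Max_ge) auto
  then show ?thesis using assms[of undefined] by linarith
qed

lemma kappa1_nonneg: "kappa1 C d \<ge> 0"
  by (simp add: kappa1_def gamma1_def sum_nonneg)

lemma kappa2_ge:
  assumes "\<And>j. d j \<ge> 1" "N > 0"
  shows "2 * (N + 2 powr (2 * (1 + 2 * gamma0 C d))) \<le> kappa2 N C d"
proof -
  have "1 * (2 * (N + 2 powr (2 * (1 + 2 * gamma0 C d))))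
      \<le> real (max_degree d) * (2 * (N + 2 powr (2 * (1 + 2 * gamma0 C d))))"
    using max_degree_ge_1[of d] assms by (intro mult_right_mono) auto
  then show ?thesis by (simp add: kappa2_def algebra_simps)
qed

text \<open>This is where the size of \<open>\<kappa>\<^sub>2\<close> is used: since \<open>\<gamma>\<^sub>0 \<ge> m + C (d\<^sub>j + 1)\<close> for every \<open>j\<close>, each of the
  \<open>m\<close> summands on the left is at most \<open>2 \<cdot> 2\<^bsup>4 (\<gamma>\<^sub>0 - m)\<^esup>\<close>, and \<open>m \<le> 2\<^bsup>4m\<^esup>\<close>.\<close>

lemma moment_exponents_le_kappa:
  fixes d :: "'m::finite \<Rightarrow> nat"
  assumes d: "\<And>j. d j \<ge> 1" and "C \<ge> 0" "N > 0"
  shows "4 * (\<Sum>j\<in>UNIV. 2 ^ moment_exponent C (d j)) \<le> kappa1 C d + kappa2 N C d"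
proof -
  let ?m = "CARD('m)"
  have gamma: "real ?m + C * (real (d j) + 1) \<le> gamma0 C d" for j
  proof -
    have term_le: "1 + C * (real (d i) + 1) \<le> real (d i) * (1 + C * (real (d i) + 2))" for i
    proof -
      have "1 * (1 + C * (real (d i) + 2)) \<le> real (d i) * (1 + C * (real (d i) + 2))"
        using d[of i] assms(2) by (intro mult_right_mono) auto
      then show ?thesis using assms(2) by (simp add: algebra_simps)
    qed
    have "C * (real (d j) + 1) \<le> (\<Sum>i\<in>UNIV. C * (real (d i) + 1))"
      using assms(2) by (intro member_le_sum) auto
    then have "real ?m + C * (real (d j) + 1) \<le> (\<Sum>i\<in>UNIV. 1 + C * (real (d i) + 1))"
      by (simp add: sum.distrib)
    also have "\<dots> \<le> gamma0 C d" unfolding gamma0_def by (intro sum_mono term_le)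
    finally show ?thesis .
  qed
  have "4 * (\<Sum>j\<in>UNIV. 2 ^ moment_exponent C (d j))
      \<le> (\<Sum>j\<in>(UNIV :: 'm set). 4 * (2 * 2 powr (4 * (gamma0 C d - real ?m))))"
    unfolding sum_distrib_left
  proof (intro sum_mono mult_left_mono)
    fix j
    have "2 powr (4 * C * (real (d j) + 1)) \<le> 2 powr (4 * (gamma0 C d - real ?m))"
      using gamma[of j] by (intro powr_mono) auto
    then show "2 ^ moment_exponent C (d j) \<le> 2 * 2 powr (4 * (gamma0 C d - real ?m))"
      using two_power_moment_exponent_le[OF assms(2), of "d j"] by linarith
  qed simp
  also have "\<dots> = 8 * (real ?m * 2 powr (4 * (gamma0 C d - real ?m)))" by simp
  also have "\<dots> \<le> 8 * (2 powr (4 * real ?m) * 2 powr (4 * (gamma0 C d - real ?m)))"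
  proof (intro mult_left_mono mult_right_mono)
    have "real ?m \<le> 2 ^ ?m" using of_nat_less_two_power[of ?m, where 'a = real] by linarith
    also have "\<dots> = 2 powr real ?m" by (simp add: powr_realpow)
    also have "\<dots> \<le> 2 powr (4 * real ?m)" by (intro powr_mono) auto
    finally show "real ?m \<le> 2 powr (4 * real ?m)" .
  qed auto
  also have "\<dots> = 2 * 2 powr (2 * (1 + 2 * gamma0 C d))"
    by (simp add: algebra_simps flip: powr_add) (simp add: powr_add)
  also have "\<dots> \<le> kappa1 C d + kappa2 N C d"
  proof -
    have "2 * N + 2 * P \<le> k \<Longrightarrow> 0 \<le> l \<Longrightarrow> 2 * P \<le> l + k" for P k l using assms(3) by linarith
    then show ?thesis
      using kappa2_ge[where d = d, OF d assms(3), of C] kappa1_nonneg[of C d]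
      unfolding distrib_left[of 2 N] by blast
  qed
  finally show ?thesis .
qed

text \<open>The second moment is at most a constant times a power of \<open>\<tau>(gcd(n))\<close> and a power of \<open>log H\<close>. Both
  are \<open>O(x\<^bsup>1/4\<^esup>)\<close>: the former by the divisor bound, since \<open>gcd(n) \<le> x\<close>, the latter by the lower
  bound on \<open>x\<close>.\<close>

lemma second_moment_asymptotic:
  fixes d :: "'m::finite \<Rightarrow> nat" and N B C :: real
  assumes d: "\<And>j. d j \<ge> 1" and "N > 0" "C \<ge> 0"
  shows "\<exists>M>0. \<forall>(f :: ('m \<Rightarrow> int) \<Rightarrow> complex) H x h n.
    (\<forall>n. cmod (f n) \<le> B * (\<Prod>j\<in>{j. n j \<noteq> 0}. real (divisor_tau (nat \<bar>n j\<bar>)) powr C)) \<longrightarrow>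
    H \<ge> 3 \<longrightarrow> ln H powr (kappa1 C d + kappa2 N C d) \<le> x \<longrightarrow> x \<le> H \<longrightarrow>
    h \<in> {\<lfloor>H\<rfloor>, 2 * \<lfloor>H\<rfloor>} \<longrightarrow> \<bar>real_of_int (fst n)\<bar> \<le> x \<longrightarrow> \<bar>real_of_int (snd n)\<bar> \<le> x \<longrightarrow>
    (\<Sum>c\<in>coeff_boxes d h. (cmod (f (form_values d c n)))\<^sup>2)
      \<le> M * x powr (1 / 2) * real (card (coeff_boxes d h))"
proof -
  define b where "b j = moment_exponent C (d j)" for j
  define \<kappa> where "\<kappa> = kappa1 C d + kappa2 N C d"
  let ?A = "2 * C * real (\<Sum>j\<in>UNIV. d j)"
  have "0 \<le> ?A" using assms by (intro mult_nonneg_nonneg of_nat_0_le_iff) auto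
  then obtain t where t: "t > 0" "\<And>g. g > 0 \<Longrightarrow> real (divisor_tau g) powr ?A \<le> t * real g powr (1 / 4)"
    using divisor_tau_powr_le[of "1 / 4" ?A] by auto
  define L where "L j = 2 + ln (2 * (real (d j) + 2))" for j
  define a where "a = (\<Prod>j\<in>UNIV. 2 ^ b j * (real (d j) + 3) ^ (d j + 1) * L j ^ (2 ^ b j))"
  have L: "L j > 0" for j unfolding L_def by (intro add_pos_nonneg) auto
  have a: "a > 0" unfolding a_def using L by (intro prod_pos) auto
  define M where "M = B\<^sup>2 * (1 + t * a) + 1"
  have "M > 0" unfolding M_def using t a by (intro add_nonneg_pos mult_nonneg_nonneg) auto
  moreover have "(\<Sum>c\<in>coeff_boxes d h. (cmod (f (form_values d c n)))\<^sup>2)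
      \<le> M * x powr (1 / 2) * real (card (coeff_boxes d h))"
    if f: "\<forall>n. cmod (f n) \<le> B * (\<Prod>j\<in>{j. n j \<noteq> 0}. real (divisor_tau (nat \<bar>n j\<bar>)) powr C)"
      and H: "H \<ge> 3" and x: "ln H powr \<kappa> \<le> x" "x \<le> H" and h: "h \<in> {\<lfloor>H\<rfloor>, 2 * \<lfloor>H\<rfloor>}"
      and n: "\<bar>real_of_int (fst n)\<bar> \<le> x" "\<bar>real_of_int (snd n)\<bar> \<le> x"
    for f :: "('m \<Rightarrow> int) \<Rightarrow> complex" and H x h n
  proof -
    have lnH: "1 < ln H" using one_less_ln_3 H by (meson ln_mono order_less_le_trans zero_less_numeral)
    have \<kappa>: "\<kappa> \<ge> 0"
      using moment_exponents_le_kappa[where d = d, OF d assms(3,2)] unfolding \<kappa>_def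
      by (meson order_trans mult_nonneg_nonneg sum_nonneg zero_le_numeral zero_le_power)
    then have "1 \<le> ln H powr \<kappa>" using lnH by (intro ge_one_powr_ge_zero) auto
    then have x1: "1 \<le> x" using x by linarith
    then have x_half: "1 \<le> x powr (1 / 2)" by (intro ge_one_powr_ge_zero) auto
    let ?V = "real (card (coeff_boxes d h))"
    let ?S = "\<Sum>c\<in>coeff_boxes d h. (cmod (f (form_values d c n)))\<^sup>2"
    show ?thesis
    proof (cases "n = (0, 0)")
      case True
      have "form_values d c n = (\<lambda>_. 0)" for c
      proof
        fix j
        have "c j k * (0 ^ (d j - k) * 0 ^ k) = 0" for k
          using d[of j] by (cases "k = 0") auto
        then show "form_values d c n j = 0"
          unfolding form_values_def form_value_def True fst_conv snd_conv by (intro sum.neutral ballI)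
      qed
      moreover have "cmod (f (\<lambda>_. 0)) \<le> B" using spec[OF f, of "\<lambda>_. 0"] by simp
      then have "(cmod (f (\<lambda>_. 0)))\<^sup>2 \<le> B\<^sup>2" by (intro power_mono) auto
      ultimately have "?S \<le> B\<^sup>2 * ?V" by (simp add: mult_left_mono mult.commute)
      also have "B\<^sup>2 \<le> M" unfolding M_def using t a by (simp add: algebra_simps)
      then have "B\<^sup>2 * ?V \<le> M * x powr (1 / 2) * ?V"
        using x_half \<open>M > 0\<close> by (intro mult_right_mono) (auto intro: order_trans)
      finally show ?thesis .
    next
      case False
      define g where "g = nat (gcd (fst n) (snd n))"
      have g: "g > 0" "real g \<le> x"
      proof -
        have "gcd (fst n) (snd n) \<noteq> 0" using False by (cases n) auto
        then have pos: "gcd (fst n) (snd n) > 0" by (simp only: order_less_le) simp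
        then show "g > 0" by (simp add: g_def)
        have "gcd (fst n) (snd n) \<le> max \<bar>fst n\<bar> \<bar>snd n\<bar>"
        proof (cases "fst n = 0")
          case False
          then show ?thesis using dvd_imp_le_int[OF _ gcd_dvd1[of "fst n" "snd n"]] by simp
        qed simp
        then have "real_of_int (gcd (fst n) (snd n)) \<le> x" using n by linarith
        then show "real g \<le> x" using pos by (simp add: g_def)
      qed
      have h_bounds: "\<lfloor>H\<rfloor> \<le> h" "real_of_int h \<le> 2 * H" "h \<ge> 1"
      proof -
        have "3 \<le> \<lfloor>H\<rfloor>" using H by (simp add: le_floor_iff)
        moreover have "h = \<lfloor>H\<rfloor> \<or> h = 2 * \<lfloor>H\<rfloor>" using h by blast
        ultimately show "\<lfloor>H\<rfloor> \<le> h" "h \<ge> 1" by linarith+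
        have "real_of_int h = real_of_int \<lfloor>H\<rfloor> \<or> real_of_int h = 2 * real_of_int \<lfloor>H\<rfloor>"
          using h by auto
        then show "real_of_int h \<le> 2 * H" using H of_int_floor_le[of H] by linarith
      qed
      have "real_of_int \<bar>fst n\<bar> \<le> H" "real_of_int \<bar>snd n\<bar> \<le> H" using n x by auto
      then have n_le: "\<bar>fst n\<bar> \<le> h" "\<bar>snd n\<bar> \<le> h"
        using h_bounds(1) unfolding le_floor_iff[symmetric] by linarith+
      have K_le: "1 + ln ((real (d j) + 2) * h) \<le> L j * ln H" for j
      proof -
        have "(real (d j) + 2) * h \<le> (real (d j) + 2) * (2 * H)"
          using h_bounds by (intro mult_left_mono) auto
        then have "ln ((real (d j) + 2) * h) \<le> ln ((2 * (real (d j) + 2)) * H)"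
          using h_bounds H by (subst ln_le_cancel_iff) (auto simp: mult_ac)
        also have "\<dots> = ln (2 * (real (d j) + 2)) + ln H"
          using H by (subst ln_mult) auto
        finally have "1 + ln ((real (d j) + 2) * h) \<le> (1 + ln (2 * (real (d j) + 2))) * 1 + ln H"
          by simp
        also have "\<dots> \<le> (1 + ln (2 * (real (d j) + 2))) * ln H + ln H"
          using lnH by (intro add_mono mult_left_mono add_nonneg_nonneg) auto
        finally show ?thesis by (simp add: L_def algebra_simps)
      qed
      have K_nonneg: "0 \<le> 1 + ln ((real (d j) + 2) * h)" for j
      proof -
        have "1 * 1 \<le> (real (d j) + 2) * h" using h_bounds by (intro mult_mono) auto
        then show ?thesis by (intro add_nonneg_nonneg ln_ge_zero) auto
      qed
      have "(\<Prod>j\<in>UNIV. 2 ^ b j * (real (d j) + 3) ^ (d j + 1) * (1 + ln ((real (d j) + 2) * h)) ^ (2 ^ b j))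
          \<le> (\<Prod>j\<in>UNIV. 2 ^ b j * (real (d j) + 3) ^ (d j + 1) * (L j * ln H) ^ (2 ^ b j))"
        by (intro prod_mono conjI mult_left_mono power_mono K_le mult_nonneg_nonneg zero_le_power K_nonneg)
          auto
      also have "\<dots> = a * ln H ^ (\<Sum>j\<in>UNIV. 2 ^ b j)"
        by (simp add: a_def power_mult_distrib power_sum mult.assoc flip: prod.distrib)
      also have "ln H ^ (\<Sum>j\<in>UNIV. 2 ^ b j) \<le> x powr (1 / 4)"
      proof -
        have "ln H ^ (\<Sum>j\<in>UNIV. 2 ^ b j) = ln H powr real (\<Sum>j\<in>UNIV. 2 ^ b j)"
          using lnH by (intro powr_realpow[symmetric]) auto
        also have "\<dots> \<le> ln H powr (\<kappa> * (1 / 4))"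
          using moment_exponents_le_kappa[where d = d, OF d assms(3,2)] lnH
          by (intro powr_mono) (auto simp: b_def \<kappa>_def)
        also have "\<dots> = (ln H powr \<kappa>) powr (1 / 4)" by (simp add: powr_powr)
        also have "\<dots> \<le> x powr (1 / 4)" using x by (intro powr_mono2) auto
        finally show ?thesis .
      qed
      finally have K_prod: "(\<Prod>j\<in>UNIV. 2 ^ b j * (real (d j) + 3) ^ (d j + 1) *
          (1 + ln ((real (d j) + 2) * h)) ^ (2 ^ b j)) \<le> a * x powr (1 / 4)"
        using a by simp
      have "real (divisor_tau g) powr ?A \<le> t * real g powr (1 / 4)" using t(2) g by blast
      also have "\<dots> \<le> t * x powr (1 / 4)"
        using g t(1) by (intro mult_left_mono powr_mono2) auto
      finally have tau_g: "real (divisor_tau g) powr ?A \<le> t * x powr (1 / 4)" .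
      have "?S \<le> B\<^sup>2 * real (divisor_tau g) powr ?A *
          (\<Prod>j\<in>UNIV. 2 ^ b j * (real (d j) + 3) ^ (d j + 1) * (1 + ln ((real (d j) + 2) * h)) ^ (2 ^ b j)) * ?V"
        unfolding g_def using f d assms(3) False n_le
        by (intro second_moment_le) (auto simp: b_def intro: moment_exponent_ge)
      also have "\<dots> \<le> B\<^sup>2 * (t * x powr (1 / 4)) * (a * x powr (1 / 4)) * ?V"
        unfolding mult.assoc[of "B\<^sup>2"]
      proof (intro mult_right_mono mult_left_mono mult_mono tau_g K_prod)
        show "0 \<le> t * x powr (1 / 4)" using t(1) by simp
      qed (auto intro!: prod_nonneg mult_nonneg_nonneg zero_le_power K_nonneg)
      also have "\<dots> = B\<^sup>2 * (t * a) * x powr (1 / 2) * ?V"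
        by (simp flip: powr_add)
      also have "\<dots> \<le> M * x powr (1 / 2) * ?V"
        by (intro mult_right_mono) (auto simp: M_def algebra_simps)
      finally show ?thesis .
    qed
  qed
  ultimately show ?thesis unfolding \<kappa>_def by blast
qed

lemma finite_moduli:
  fixes y :: "'m::finite \<Rightarrow> real"
  shows "finite {q :: 'm \<Rightarrow> int. \<forall>j. q j \<noteq> 0 \<and> real_of_int \<bar>q j\<bar> \<le> y j}"
  by (rule finite_subset[OF _ finite_int_box[of "\<lambda>j. - y j" y]]) (auto simp: abs_le_iff minus_le_iff)

theorem corollary2p17:
  fixes d :: "'m::finite \<Rightarrow> nat" and N B C :: real
  assumes "\<And>j. d j \<ge> 1" and "N > 0" and "B > 0" and "C \<ge> 0"
  shows "\<exists>c>0. \<forall>(f :: ('m \<Rightarrow> int) \<Rightarrow> complex) (a :: int \<times> int \<Rightarrow> complex) (H :: real) (x :: real).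
    (\<forall>n. cmod (f n) \<le> B * (\<Prod>j\<in>{j. n j \<noteq> 0}. real (divisor_tau (nat \<bar>n j\<bar>)) powr C)) \<longrightarrow>
    (\<forall>n. cmod (a n) \<le> 1) \<longrightarrow>
    H \<ge> 3 \<longrightarrow>
    ln H powr (kappa1 C d + kappa2 N C d) \<le> x \<longrightarrow> x \<le> H \<longrightarrow>
    1 / real (card (forms_Z d H)) *
      (\<Sum>F\<in>forms_Z d H.
        (cmod (1 / complex_of_real (x ^ 2) *
          (\<Sum>n\<in>{n. \<bar>real_of_int (fst n)\<bar> \<le> x \<and> \<bar>real_of_int (snd n)\<bar> \<le> x}.
            a n * f (\<lambda>j. bieval (F j) n)))) ^ 2)
    \<le> c * (1 / ln x powr N +
        ln H powr (2 * real CARD('m) * kappa1 C d) *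
        ln x powr (2 * real CARD('m) * kappa2 N C d + real CARD('m)) *
        x ^ (4 * (\<Sum>j\<in>UNIV. d j)) *
        (MAX q\<in>{q :: 'm \<Rightarrow> int. \<forall>j. q j \<noteq> 0 \<and> real_of_int \<bar>q j\<bar> \<le> 2 * x ^ (2 * d j)}.
          equidist_error f (\<lambda>j. (1 + real (d j)) * x ^ d j * H) q / H ^ CARD('m)) ^ 2)"
proof -
  let ?m = "CARD('m)"
  define \<kappa> where "\<kappa> = kappa1 C d + kappa2 N C d"
  define E where "E = 2 * real ?m * kappa2 N C d + real ?m"
  obtain M where M: "M > 0" and moment: "\<And>(f :: ('m \<Rightarrow> int) \<Rightarrow> complex) H x h n.
      (\<forall>n. cmod (f n) \<le> B * (\<Prod>j\<in>{j. n j \<noteq> 0}. real (divisor_tau (nat \<bar>n j\<bar>)) powr C)) \<Longrightarrow>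
      H \<ge> 3 \<Longrightarrow> ln H powr (kappa1 C d + kappa2 N C d) \<le> x \<Longrightarrow> x \<le> H \<Longrightarrow>
      h \<in> {\<lfloor>H\<rfloor>, 2 * \<lfloor>H\<rfloor>} \<Longrightarrow> \<bar>real_of_int (fst n)\<bar> \<le> x \<Longrightarrow> \<bar>real_of_int (snd n)\<bar> \<le> x \<Longrightarrow>
      (\<Sum>c\<in>coeff_boxes d h. (cmod (f (form_values d c n)))\<^sup>2)
        \<le> M * x powr (1 / 2) * real (card (coeff_boxes d h))"
    using second_moment_asymptotic[where d = d and B = B, OF assms(1,2,4)] by blast
  obtain c\<^sub>1 where c\<^sub>1: "c\<^sub>1 > 0" "\<And>x. x \<ge> 1 \<Longrightarrow> (1 + ln x) powr N \<le> c\<^sub>1 * x powr (1 / 2)"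
    using one_plus_ln_powr_le[of "1 / 2" N] assms(2) by auto
  have kappa2: "2 * N \<le> kappa2 N C d" "0 < kappa2 N C d"
    using kappa2_ge[where d = d, OF assms(1,2), of C] assms(2) by (smt (verit) powr_ge_zero)+
  have m: "1 \<le> real ?m" by (simp add: Suc_leI)
  have \<kappa>: "\<kappa> > 0" using kappa2 kappa1_nonneg[of C d] by (simp add: \<kappa>_def)
  have NE: "N \<le> E"
  proof -
    have "N \<le> 1 * kappa2 N C d" using kappa2 assms(2) by simp
    also have "\<dots> \<le> (2 * real ?m) * kappa2 N C d" using kappa2 m by (intro mult_right_mono) linarith+
    finally show ?thesis by (simp add: E_def)
  qed
  \<comment> \<open>Since \<open>x \<ge> (ln 3)\<^sup>\<kappa>\<close> and \<open>ln 3 > 1\<close>, the number \<open>ln x\<close> is bounded away from \<open>0\<close>, so a larger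
     exponent of \<open>ln x\<close> costs only a constant.\<close>
  define l where "l = \<kappa> * ln (ln 3)"
  have l: "l > 0" using \<kappa> one_less_ln_3 by (simp add: l_def)
  define c\<^sub>2 where "c\<^sub>2 = l powr (N - E)"
  define A where "A = 81 * 4 ^ ?m * 2 ^ (\<Sum>j\<in>UNIV. d j + 1) * (1 + M)"
  have A: "A \<ge> 0" using M by (simp add: A_def)
  define c where "c = 54 * M * c\<^sub>1 + A * (1 + c\<^sub>2)"
  have "c > 0" using M c\<^sub>1 A by (auto simp: c_def c\<^sub>2_def intro!: add_pos_nonneg)
  moreover have "1 / real (card (forms_Z d H)) *
      (\<Sum>F\<in>forms_Z d H.
        (cmod (1 / complex_of_real (x ^ 2) *
          (\<Sum>n\<in>{n. \<bar>real_of_int (fst n)\<bar> \<le> x \<and> \<bar>real_of_int (snd n)\<bar> \<le> x}.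
            a n * f (\<lambda>j. bieval (F j) n)))) ^ 2)
    \<le> c * (1 / ln x powr N +
        ln H powr (2 * real CARD('m) * kappa1 C d) *
        ln x powr (2 * real CARD('m) * kappa2 N C d + real CARD('m)) *
        x ^ (4 * (\<Sum>j\<in>UNIV. d j)) *
        (MAX q\<in>{q :: 'm \<Rightarrow> int. \<forall>j. q j \<noteq> 0 \<and> real_of_int \<bar>q j\<bar> \<le> 2 * x ^ (2 * d j)}.
          equidist_error f (\<lambda>j. (1 + real (d j)) * x ^ d j * H) q / H ^ CARD('m)) ^ 2)"
    (is "?lhs \<le> c * (_ + _ * _ * _ * (MAX q\<in>?Q. ?err q) ^ 2)")
    if f: "\<forall>n. cmod (f n) \<le> B * (\<Prod>j\<in>{j. n j \<noteq> 0}. real (divisor_tau (nat \<bar>n j\<bar>)) powr C)"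
      and a: "\<forall>n. cmod (a n) \<le> 1" and H: "H \<ge> 3"
      and x: "ln H powr (kappa1 C d + kappa2 N C d) \<le> x" "x \<le> H"
    for f :: "('m \<Rightarrow> int) \<Rightarrow> complex" and a :: "int \<times> int \<Rightarrow> complex" and H x :: real
  proof -
    have lnH: "ln 3 \<le> ln H" "1 < ln H" using H one_less_ln_3 by (auto intro: order_less_le_trans)
    have "1 < ln H powr \<kappa>" using lnH \<kappa> by simp
    then have x1: "1 < x" using x by (simp add: \<kappa>_def)
    have lnx: "l \<le> ln x"
    proof -
      have "l \<le> \<kappa> * ln (ln H)"
        unfolding l_def using \<kappa> lnH one_less_ln_3 by (intro mult_left_mono) auto
      also have "\<dots> = ln (ln H powr \<kappa>)" using lnH by (simp add: ln_powr)
      also have "\<dots> \<le> ln x" using x lnH x1 by (subst ln_le_cancel_iff) (auto simp: \<kappa>_def)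
      finally show ?thesis .
    qed
    define e where "e = (MAX q\<in>?Q. ?err q)"
    have fin: "finite (?err ` ?Q)" by (intro finite_imageI finite_moduli)
    have err_le: "?err q \<le> e" if "q \<in> ?Q" for q
      unfolding e_def using fin that by (intro Max_ge) auto
    have e: "e \<ge> 0"
    proof -
      have "1 * 1 \<le> 2 * x ^ (2 * d j)" for j
        using x1 by (intro mult_mono one_le_power) auto
      then have "(\<lambda>_. 1) \<in> ?Q" by simp
      moreover have "0 \<le> ?err (\<lambda>_. 1)"
        using x1 H by (intro divide_nonneg_nonneg equidist_error_nonneg) auto
      ultimately show ?thesis using err_le by (meson order_trans)
    qed
    have "?lhs \<le> 54 * (M * x powr (1 / 2)) / x +
        81 * 4 ^ ?m * 2 ^ (\<Sum>j\<in>UNIV. d j + 1) * (1 + M * x powr (1 / 2)) * x ^ ?m * e"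
    proof (rule mean_square_le)
      show "equidist_error f (\<lambda>j. (1 + real (d j)) * x ^ d j * H) q \<le> e * H ^ ?m"
        if "\<And>j. q j \<noteq> 0 \<and> real_of_int \<bar>q j\<bar> \<le> 2 * x ^ (2 * d j)" for q
        using err_le[of q] that H by (simp add: pos_divide_le_eq)
      show "(\<Sum>c\<in>coeff_boxes d h. (cmod (f (form_values d c n)))\<^sup>2)
          \<le> M * x powr (1 / 2) * real (card (coeff_boxes d h))"
        if "h \<in> {\<lfloor>H\<rfloor>, 2 * \<lfloor>H\<rfloor>}" "\<bar>real_of_int (fst n)\<bar> \<le> x" "\<bar>real_of_int (snd n)\<bar> \<le> x" for h n
        using moment[OF f H x that] .
    qed (use assms a x x1 M e in auto)
    also have "\<dots> \<le> 54 * M * c\<^sub>1 * (1 / ln x powr N) + A * (x powr (1 / 2) * x ^ ?m * e)"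
    proof (rule add_mono)
      have half: "x powr (1 / 2) * x powr (1 / 2) = x" using x1 by (simp flip: powr_add)
      have "ln x powr N \<le> (1 + ln x) powr N" using x1 assms(2) by (intro powr_mono2) auto
      also have "\<dots> \<le> c\<^sub>1 * x powr (1 / 2)" using c\<^sub>1 x1 by simp
      finally have "ln x powr N * x powr (1 / 2) \<le> c\<^sub>1 * x powr (1 / 2) * x powr (1 / 2)"
        by (intro mult_right_mono) auto
      then have "ln x powr N * x powr (1 / 2) \<le> c\<^sub>1 * x" using half by (simp add: mult.assoc)
      moreover have "ln x powr N > 0" using x1 by simp
      ultimately have "x powr (1 / 2) / x \<le> c\<^sub>1 * (1 / ln x powr N)"
        using x1 by (simp add: field_simps)
      then have "54 * M * (x powr (1 / 2) / x) \<le> 54 * M * (c\<^sub>1 * (1 / ln x powr N))"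
        using M by (intro mult_left_mono) auto
      then show "54 * (M * x powr (1 / 2)) / x \<le> 54 * M * c\<^sub>1 * (1 / ln x powr N)"
        by (simp add: mult.assoc)
      have "1 \<le> x powr (1 / 2)" using x1 by (intro ge_one_powr_ge_zero) auto
      then have "1 + M * x powr (1 / 2) \<le> (1 + M) * x powr (1 / 2)" by (simp add: algebra_simps)
      then have "81 * 4 ^ ?m * 2 ^ (\<Sum>j\<in>UNIV. d j + 1) * (1 + M * x powr (1 / 2)) * x ^ ?m * e
          \<le> 81 * 4 ^ ?m * 2 ^ (\<Sum>j\<in>UNIV. d j + 1) * ((1 + M) * x powr (1 / 2)) * x ^ ?m * e"
        using x1 e by (intro mult_right_mono mult_left_mono) auto
      then show "81 * 4 ^ ?m * 2 ^ (\<Sum>j\<in>UNIV. d j + 1) * (1 + M * x powr (1 / 2)) * x ^ ?m * e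
          \<le> A * (x powr (1 / 2) * x ^ ?m * e)"
        by (simp add: A_def mult.assoc)
    qed
    also have "x powr (1 / 2) * x ^ ?m * e \<le> 1 / ln x powr N + c\<^sub>2 *
        (ln H powr (2 * real ?m * kappa1 C d) * ln x powr E * x ^ (4 * (\<Sum>j\<in>UNIV. d j)) * e ^ 2)"
    proof -
      define p where "p = ln x powr N"
      define y where "y = x powr (1 / 2) * x ^ ?m * e"
      have p: "p > 0" using x1 by (simp add: p_def)
      have y: "y \<ge> 0" using x1 e by (simp add: y_def)
      \<comment> \<open>This step introduces the square of the equidistribution error.\<close>
      have "y \<le> 1 / p + p * y ^ 2"
      proof -
        have "0 \<le> (1 - p * y)\<^sup>2" by simp
        then have "2 * (p * y) \<le> 1 + (p * y)\<^sup>2" by (simp add: power2_diff)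
        moreover have "0 \<le> p * y" using p y by simp
        ultimately have "p * y \<le> 1 + (p * y)\<^sup>2" by linarith
        then show ?thesis using p by (simp add: field_simps power2_eq_square)
      qed
      also have "p * y ^ 2 \<le> c\<^sub>2 *
        (ln H powr (2 * real ?m * kappa1 C d) * ln x powr E * x ^ (4 * (\<Sum>j\<in>UNIV. d j)) * e ^ 2)"
      proof -
        have "p = ln x powr (N - E) * ln x powr E" by (simp add: p_def flip: powr_add)
        also have "\<dots> \<le> c\<^sub>2 * ln x powr E"
          unfolding c\<^sub>2_def using lnx l NE by (intro mult_right_mono powr_mono2') auto
        finally have p_le: "p \<le> c\<^sub>2 * ln x powr E" .
        have y_sq: "y ^ 2 = x ^ (2 * ?m + 1) * e ^ 2"
        proof -
          have "(x powr (1 / 2))\<^sup>2 = x" using x1 by (simp add: power2_eq_square flip: powr_add)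
          then show ?thesis by (simp add: y_def power_mult_distrib power_mult[symmetric] mult.commute)
        qed
        have "?m \<le> (\<Sum>j\<in>UNIV. d j)"
          using sum_mono[of "UNIV :: 'm set" "\<lambda>_. 1" d] assms(1) by simp
        moreover have "1 \<le> ?m" by (simp add: Suc_leI)
        ultimately have "2 * ?m + 1 \<le> 4 * (\<Sum>j\<in>UNIV. d j)" by linarith
        then have "x ^ (2 * ?m + 1) \<le> x ^ (4 * (\<Sum>j\<in>UNIV. d j))"
          using x1 by (intro power_increasing) auto
        then have "p * y ^ 2 \<le> (c\<^sub>2 * ln x powr E) * (x ^ (4 * (\<Sum>j\<in>UNIV. d j)) * e ^ 2)"
          unfolding y_sq using p_le p x1 by (intro mult_mono mult_right_mono) auto
        also have "\<dots> = c\<^sub>2 * (1 * ln x powr E * x ^ (4 * (\<Sum>j\<in>UNIV. d j)) * e ^ 2)"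
          by (simp add: mult.assoc)
        also have "\<dots> \<le> c\<^sub>2 *
            (ln H powr (2 * real ?m * kappa1 C d) * ln x powr E * x ^ (4 * (\<Sum>j\<in>UNIV. d j)) * e ^ 2)"
          using lnH x1 kappa1_nonneg[of C d]
          by (intro mult_left_mono mult_right_mono ge_one_powr_ge_zero) (auto simp: c\<^sub>2_def)
        finally show ?thesis .
      qed
      finally show ?thesis unfolding y_def p_def by simp
    qed
    finally have "?lhs \<le> 54 * M * c\<^sub>1 * (1 / ln x powr N) + A * (1 / ln x powr N + c\<^sub>2 *
        (ln H powr (2 * real ?m * kappa1 C d) * ln x powr E * x ^ (4 * (\<Sum>j\<in>UNIV. d j)) * e ^ 2))"
      using A by (simp add: mult_left_mono)
    also have "\<dots> \<le> c * (1 / ln x powr N +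
        ln H powr (2 * real ?m * kappa1 C d) * ln x powr E * x ^ (4 * (\<Sum>j\<in>UNIV. d j)) * e ^ 2)"
    proof -
      define u v where "u = 1 / ln x powr N" and "v = ln H powr (2 * real ?m * kappa1 C d) *
        ln x powr E * x ^ (4 * (\<Sum>j\<in>UNIV. d j)) * e ^ 2"
      have "0 \<le> u" "0 \<le> v" using x1 by (auto simp: u_def v_def)
      then have "0 \<le> A * c\<^sub>2 * u" "0 \<le> (54 * M * c\<^sub>1 + A) * v"
        using A M c\<^sub>1 by (auto simp: c\<^sub>2_def)
      then have "54 * M * c\<^sub>1 * u + A * (u + c\<^sub>2 * v) \<le> c * (u + v)"
        by (simp add: c_def algebra_simps)
      then show ?thesis by (simp add: u_def v_def)
    qed
    finally show ?thesis unfolding E_def e_def .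
  qed
  ultimately show ?thesis by blast
qed

end
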